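(* Let $G$ be a hyperbolic group. Then there is a polynomial $p(x)$ such that for all $k$ and all $g_1,\ldots,g_k,g\in G$: if there exist integers $\varepsilon_1,\ldots,\varepsilon_k\in\mathbb{Z}$ such that $$g=g_1^{\varepsilon_1}\cdots g_k^{\varepsilon_k},$$ then there exist such integers $\varepsilon_1,\ldots,\varepsilon_k\in\mathbb{Z}$ (i.e., satisfying the same equality) with $$\max\{|\varepsilon_1|,\ldots,|\varepsilon_k|\}\le p(|g_1|+\ldots+|g_k|+|g|).$$
   Context: A finite generating set $X$ of $G$ is fixed, and $|h|$ denotes the geodesic (word) length of $h\in G$ with respect to $X$. The polynomial $p$ depends only on $G$ and $X$. *)

theory Defs
  imports "HOL-Algebra.Generated_Groups" "HOL-Computational_Algebra.Polynomial" Complex_Main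
begin

definition list_mult :: "('a, 'b) monoid_scheme \<Rightarrow> 'a list \<Rightarrow> 'a" where
  "list_mult G xs = foldr (\<lambda>x y. x \<otimes>\<^bsub>G\<^esub> y) xs \<one>\<^bsub>G\<^esub>"

definition finite_generating_set :: "('a, 'b) monoid_scheme \<Rightarrow> 'a set \<Rightarrow> bool" where
  "finite_generating_set G X \<longleftrightarrow> finite X \<and> X \<subseteq> carrier G \<and> generate G X = carrier G"

definition letters :: "('a, 'b) monoid_scheme \<Rightarrow> 'a set \<Rightarrow> 'a set" where
  "letters G X = X \<union> (\<lambda>x. inv\<^bsub>G\<^esub> x) ` X"

text \<open>The least element below exists whenever \<open>X\<close> generates \<open>G\<close> and \<open>h\<close> lies in the carrier,
  the only case of interest.\<close>

definition word_length :: "('a, 'b) monoid_scheme \<Rightarrow> 'a set \<Rightarrow> 'a \<Rightarrow> nat" where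
  "word_length G X h =
     (LEAST n. \<exists>ws. length ws = n \<and> set ws \<subseteq> letters G X \<and> list_mult G ws = h)"

definition word_dist :: "('a, 'b) monoid_scheme \<Rightarrow> 'a set \<Rightarrow> 'a \<Rightarrow> 'a \<Rightarrow> nat" where
  "word_dist G X u v = word_length G X (inv\<^bsub>G\<^esub> u \<otimes>\<^bsub>G\<^esub> v)"

text \<open>Paths in the Cayley graph of \<open>G\<close> with respect to \<open>X\<close> are represented by their nonempty
  lists of vertices; edges join \<open>u\<close> to \<open>u x\<close> for \<open>x\<close> a generator or the inverse of one.\<close>

definition cayley_path :: "('a, 'b) monoid_scheme \<Rightarrow> 'a set \<Rightarrow> 'a list \<Rightarrow> bool" where
  "cayley_path G X vs \<longleftrightarrow> vs \<noteq> [] \<and> set vs \<subseteq> carrier G \<and>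
     (\<forall>i. Suc i < length vs \<longrightarrow> (\<exists>x \<in> letters G X. vs ! Suc i = vs ! i \<otimes>\<^bsub>G\<^esub> x))"

definition cayley_geodesic ::
  "('a, 'b) monoid_scheme \<Rightarrow> 'a set \<Rightarrow> 'a \<Rightarrow> 'a \<Rightarrow> 'a list \<Rightarrow> bool" where
  "cayley_geodesic G X u v vs \<longleftrightarrow> cayley_path G X vs \<and> hd vs = u \<and> last vs = v \<and>
     length vs = Suc (word_dist G X u v)"

text \<open>Every geodesic triangle of the Cayley graph is \<open>\<delta>\<close>-slim. The sides are cyclically oriented,
  so the condition on the single side \<open>p\<close>, imposed on all triangles, covers all three sides.
  Corners and points of triangles are vertices of the graph; allowing points in the interior of
  edges would only change the constant \<open>\<delta>\<close>.\<close>

definition slim_triangles :: "('a, 'b) monoid_scheme \<Rightarrow> 'a set \<Rightarrow> real \<Rightarrow> bool" where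
  "slim_triangles G X \<delta> \<longleftrightarrow>
     (\<forall>u v w p q r. cayley_geodesic G X u v p \<and> cayley_geodesic G X v w q \<and>
        cayley_geodesic G X w u r \<longrightarrow>
        (\<forall>a \<in> set p. \<exists>b \<in> set q \<union> set r. real (word_dist G X a b) \<le> \<delta>))"

definition hyperbolic_group :: "('a, 'b) monoid_scheme \<Rightarrow> bool" where
  "hyperbolic_group G \<longleftrightarrow> group G \<and>
     (\<exists>Y \<delta>. finite_generating_set G Y \<and> slim_triangles G Y \<delta>)"

end

theory Submission imports Defs begin

text \<open>Slim triangles give the four-point inequality, in which the Gromov product loses only a
  logarithmic amount along a polygon. Every element \<open>w\<close> either has bounded order or has a power
  \<open>w^j\<close>, with \<open>j\<close> bounded, that translates a point \<open>z\<close> with \<open>|z| = O(|w|)\<close> along a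
  local quasi-geodesic whose constants depend only on \<open>G\<close>: take \<open>z\<close> to be the midpoint of a
  geodesic from \<open>1\<close> to a sufficiently long power of \<open>w\<close>. Choose a solution with
  lexicographically minimal \<open>(|\<epsilon>\<^sub>1|, \<dots>, |\<epsilon>\<^sub>k|)\<close> and look at the polygon whose sides are these
  quasi-geodesics. A point of one side is \<open>O(log k)\<close>-close to another side, or else near a corner.
  Two points of a side with the same displacement to another side would allow an exchange of
  exponents that contradicts minimality, so the length of a side is bounded by the size of a ball
  of radius \<open>O(log k)\<close> times a polynomial.\<close>

section \<open>Hyperbolicity of pseudo-metrics and word metrics\<close>

text \<open>The obstacle is uniformity. The powers of one element of infinite order form a
  quasi-geodesic, but its constants depend on the element, and the unit may lie far from the axis
  along which it translates. Moving the base point to \<open>z\<close> makes consecutive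
  displacements exceed \<open>10 * D + 1\<close> and Gromov products at most \<open>7 * D\<close>,
  whatever \<open>w\<close> is; a local-to-global principle then applies. The price is an extra edge
  of length O(|w|) at each end of a side.

  The logarithm is what keeps the bound polynomial: balls grow exponentially, but a ball of radius
  O(log k) has only polynomially many elements in k.

  An exchange may lower one exponent and raise the other; in the lexicographic order only the
  earlier one counts.

  Two transfers remain. Slimness is given for some generating set \<open>Y\<close>, while lengths
  are measured in \<open>X\<close>; \<open>Y\<close>-lengths are at most a constant times
  \<open>X\<close>-lengths. And k exceeds the sum of the lengths if many factors are trivial, so
  these are deleted beforehand. Distances and doubled Gromov products are integers
  throughout.\<close>

locale geodesic_dist =
  fixes d :: "'p \<Rightarrow> 'p \<Rightarrow> int"
  assumes d_self [simp]: "d x x = 0"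
    and d_commute: "d x y = d y x"
    and d_triangle: "d x z \<le> d x y + d y z"
    and d_interp: "0 \<le> t \<Longrightarrow> t \<le> d x y \<Longrightarrow> \<exists>p. d x p = t \<and> d p y = d x y - t"
begin

lemma d_nonneg [simp]: "0 \<le> d x y"
  using d_triangle[of x x y] d_commute[of x y] by simp

text \<open>Twice the Gromov product of \<open>x\<close> and \<open>y\<close> with respect to the base point \<open>w\<close>.\<close>

definition gp :: "'p \<Rightarrow> 'p \<Rightarrow> 'p \<Rightarrow> int" where
  "gp w x y = d w x + d w y - d x y"

lemma gp_commute: "gp w x y = gp w y x"
  by (simp add: gp_def d_commute)

lemma gp_nonneg: "0 \<le> gp w x y"
  using d_triangle[of x y w] by (simp add: gp_def d_commute)

text \<open>Walk from \<open>x\<close> to \<open>y\<close> and let \<open>p\<close> be the last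
  point within \<delta> of a geodesic from \<open>x\<close> to \<open>w\<close>. Its successor must
  be within \<delta> of a geodesic from \<open>y\<close> to \<open>w\<close>, so \<open>p\<close> is
  close to both, and adding the two resulting bounds on \<open>d w p\<close> gives the Gromov
  product.\<close>

lemma slim_imp_near_geodesic:
  assumes slim: "\<And>u v w p. d u p + d p v = d u v \<Longrightarrow>
      \<exists>b. (d v b + d b w = d v w \<or> d w b + d b u = d w u) \<and> d p b \<le> \<delta>"
  shows "\<exists>p. d x p + d p y = d x y \<and> 2 * d w p \<le> gp w x y + 4 * \<delta> + 2"
proof -
  obtain b0 where "d x b0 \<le> \<delta>"
    using slim[of x x x x] by auto
  then have \<delta>: "0 \<le> \<delta>"
    using d_nonneg[of x b0] by linarith
  define near where "near p \<longleftrightarrow> d x p + d p y = d x y \<and> (\<exists>s. d x s + d s w = d x w \<and> d p s \<le> \<delta>)" for p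
  have "near x"
    unfolding near_def using \<delta> by (auto intro!: exI[of _ x])
  moreover have "\<forall>p. near p \<longrightarrow> nat (d x p) < nat (d x y + 1)"
    using d_nonneg unfolding near_def by (smt (verit) nat_mono_iff)
  ultimately obtain p where p: "near p" and max: "\<And>q. near q \<Longrightarrow> nat (d x q) \<le> nat (d x p)"
    using ex_has_greatest_nat[of near x "\<lambda>p. nat (d x p)" "nat (d x y + 1)"]
    by (metis less_or_eq_imp_le)
  obtain s where s: "d x s + d s w = d x w" "d p s \<le> \<delta>" and pxy: "d x p + d p y = d x y"
    using p unfolding near_def by blast
  \<comment> \<open>\<open>q\<close> is the successor of \<open>p\<close>, or \<open>y\<close>
    itself if the walk has already reached \<open>y\<close>.\<close>
  obtain q s' where q: "d x q + d q y = d x y" "d p q \<le> 1"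
    and s': "d y s' + d s' w = d y w" "d q s' \<le> \<delta>"
  proof (cases "d p y = 0")
    case True
    then show thesis
      using that[of y y] pxy \<delta> by simp
  next
    case False
    then have "1 \<le> d p y"
      using d_nonneg[of p y] by linarith
    then obtain q where q: "d p q = 1" "d q y = d p y - 1"
      using d_interp[of 1 p y] by auto
    have q': "d x q + d q y = d x y" "d x q = d x p + 1"
      using q pxy d_triangle[of x q p] d_triangle[of x y q] by linarith+
    then have "\<not> near q"
      using max[of q] d_nonneg[of x p] by (auto simp: nat_le_eq_zle)
    moreover obtain b where "d y b + d b w = d y w \<or> d w b + d b x = d w x" "d q b \<le> \<delta>"
      using slim[OF q'(1)] by blast
    ultimately have "d y b + d b w = d y w"
      using q'(1) unfolding near_def by (smt (verit) d_commute)
    then show thesis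
      using that[OF q'(1) _ _ \<open>d q b \<le> \<delta>\<close>] q by simp
  qed
  have "2 * d w p \<le> gp w x y + 4 * \<delta> + 2"
    using s s' q pxy d_triangle[of w p s] d_triangle[of p x s] d_triangle[of w p q] d_triangle[of w q s']
      d_triangle[of q y s'] d_triangle[of p y q] d_commute
    unfolding gp_def by (smt (verit))
  then show ?thesis
    using pxy by blast
qed

text \<open>Take \<open>p\<close> between \<open>x\<close> and \<open>z\<close> at distance about
  half of \<open>gp w x z\<close> from \<open>w\<close>. Slimness gives a point \<open>b\<close>
  near \<open>p\<close> on one of the other two sides of the triangle \<open>x\<close>,
  \<open>z\<close>, \<open>y\<close>; which side it is decides which of the two sums
  dominates.\<close>

lemma slim_imp_four_point:
  assumes slim: "\<And>u v w p. d u p + d p v = d u v \<Longrightarrow>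
      \<exists>b. (d v b + d b w = d v w \<or> d w b + d b u = d w u) \<and> d p b \<le> \<delta>"
  shows "d x z + d w y \<le> max (d x y + d w z) (d y z + d w x) + (6 * \<delta> + 2)"
proof -
  obtain p where p: "d x p + d p z = d x z" "2 * d w p \<le> gp w x z + 4 * \<delta> + 2"
    using slim_imp_near_geodesic[OF slim] by blast
  obtain b where b: "d z b + d b y = d z y \<or> d y b + d b x = d y x" "d p b \<le> \<delta>"
    using slim[OF p(1)] by blast
  have "d w b \<le> d w p + \<delta>"
    using b(2) d_triangle[of w b p] by linarith
  then show ?thesis
    using b(1) p(2) d_triangle[of w z b] d_triangle[of w y b] d_triangle[of w x b] d_commute
    unfolding gp_def by (smt (verit))
qed

end

section \<open>Consequences of the four-point inequality\<close>

locale hyperbolic_dist = geodesic_dist +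
  fixes D :: int
  assumes four_point: "d x z + d w y \<le> max (d x y + d w z) (d y z + d w x) + D"
begin

lemma D_nonneg: "0 \<le> D"
  using four_point[of undefined undefined undefined undefined] by simp

lemma gp_min: "min (gp w x y) (gp w y z) \<le> gp w x z + D"
  using four_point[of x z w y] unfolding gp_def by linarith

text \<open>Bisecting the chain costs one \<open>D\<close> per halving, hence \<open>N\<close> times
  \<open>D\<close> for at most \<open>2 ^ N\<close> edges instead of one \<open>D\<close> per
  edge.\<close>

lemma gp_chain:
  assumes "s < t" "t - s \<le> 2 ^ N"
    and "\<And>e. s \<le> e \<Longrightarrow> e < t \<Longrightarrow> M < gp w (f e) (f (Suc e))"
  shows "M - int N * D < gp w (f s) (f t)"
  using assms
proof (induction N arbitrary: s t)
  case 0
  then have "t = Suc s"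
    by simp
  then show ?case
    using 0(3)[of s] by simp
next
  case (Suc N)
  show ?case
  proof (cases "t - s \<le> 2 ^ N")
    case True
    have "M - int N * D < gp w (f s) (f t)"
      by (rule Suc.IH[OF Suc.prems(1) True]) (use Suc.prems(3) in auto)
    moreover have "int (Suc N) * D = int N * D + D"
      by (simp add: algebra_simps)
    ultimately show ?thesis
      using D_nonneg by linarith
  next
    case False
    define m where "m = s + 2 ^ N"
    have m: "s < m" "m < t" "m - s \<le> 2 ^ N" "t - m \<le> 2 ^ N"
      using False Suc.prems(2) by (auto simp: m_def)
    have "M - int N * D < gp w (f s) (f m)"
      by (rule Suc.IH) (use Suc.prems(3) m in auto)
    moreover have "M - int N * D < gp w (f m) (f t)"
      by (rule Suc.IH) (use Suc.prems(3) m in auto)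
    moreover have "int (Suc N) * D = int N * D + D"
      by (simp add: algebra_simps)
    ultimately show ?thesis
      using gp_min[of w "f s" "f m" "f t"] by linarith
  qed
qed

text \<open>By induction the chain does not turn back at \<open>x n\<close>, so seen from
  \<open>x (Suc n)\<close> the points \<open>x n\<close> and \<open>x 0\<close> lie in the same
  direction: their product is at least \<open>2 * L - (c + D)\<close>, which exceeds
  \<open>c + D\<close>. Since \<open>x n\<close> and the next point have a small product, so have
  \<open>x 0\<close> and the next point.\<close>

lemma local_to_global_step:
  assumes "\<And>i. i < N \<Longrightarrow> L \<le> d (x i) (x (Suc i))"
    and "\<And>i. Suc i < N \<Longrightarrow> gp (x (Suc i)) (x i) (x (Suc (Suc i))) \<le> c"
    and "0 \<le> c" and "c + D < L" and "n < N"
  shows "gp (x n) (x 0) (x (Suc n)) \<le> c + D"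
  using \<open>n < N\<close>
proof (induction n)
  case 0
  show ?case
    using \<open>0 \<le> c\<close> D_nonneg by (simp add: gp_def)
next
  case (Suc n)
  then have IH: "gp (x n) (x 0) (x (Suc n)) \<le> c + D"
    by simp
  have "min (gp (x (Suc n)) (x n) (x 0)) (gp (x (Suc n)) (x 0) (x (Suc (Suc n)))) \<le> c + D"
    using gp_min[of "x (Suc n)" "x n" "x 0" "x (Suc (Suc n))"] assms(2)[OF Suc.prems] by linarith
  moreover have "c + D < gp (x (Suc n)) (x n) (x 0)"
    using IH assms(1)[of n] assms(4) Suc.prems unfolding gp_def
    by (smt (verit) Suc_lessD d_commute)
  ultimately show ?case
    by linarith
qed

lemma local_to_global_growth:
  assumes "\<And>i. i < N \<Longrightarrow> L \<le> d (x i) (x (Suc i))"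
    and "\<And>i. Suc i < N \<Longrightarrow> gp (x (Suc i)) (x i) (x (Suc (Suc i))) \<le> c"
    and "0 \<le> c" and "c + D < L" and "a \<le> b" "b \<le> N"
  shows "int (b - a) \<le> d (x a) (x b)"
proof -
  have "int n \<le> d (x (a + 0)) (x (a + n))" if "n \<le> N - a" for n
    using that
  proof (induction n)
    case (Suc n)
    have "gp (x (a + n)) (x (a + 0)) (x (a + Suc n)) \<le> c + D"
      by (rule local_to_global_step[where N = "N - a" and L = L])
        (use assms Suc.prems in auto)
    moreover have "L \<le> d (x (a + n)) (x (a + Suc n))"
      using assms(1)[of "a + n"] Suc.prems by auto
    moreover have "int n \<le> d (x (a + 0)) (x (a + n))"
      using Suc by auto
    ultimately show ?case
      using assms(4) d_commute unfolding gp_def by (smt (verit) of_nat_Suc)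
  qed simp
  from this[of "b - a"] show ?thesis
    using assms(5,6) by simp
qed

text \<open>The previous step is used twice, forwards up to \<open>x a\<close> and on the reversed
  chain up to \<open>x (Suc a)\<close>. The second use shows that \<open>x N\<close> and
  \<open>x (Suc a)\<close> lie in the same direction from \<open>x a\<close>, so \<open>x N\<close>
  can replace \<open>x (Suc a)\<close> in the first.\<close>

lemma local_to_global_aligned:
  assumes "\<And>i. i < N \<Longrightarrow> L \<le> d (x i) (x (Suc i))"
    and "\<And>i. Suc i < N \<Longrightarrow> gp (x (Suc i)) (x i) (x (Suc (Suc i))) \<le> c"
    and "0 \<le> c" and "2 * c + 3 * D < 2 * L" and "a \<le> N"
  shows "gp (x a) (x 0) (x N) \<le> c + 2 * D"
proof (cases "a = N")
  case True
  then show ?thesis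
    using assms(3) D_nonneg by (simp add: gp_def d_commute)
next
  case False
  then have a: "a < N"
    using assms(5) by simp
  have L: "c + D < L"
    using assms(4) D_nonneg by linarith
  have 1: "gp (x a) (x 0) (x (Suc a)) \<le> c + D"
    by (rule local_to_global_step[where N = N and L = L]) (use assms L a in auto)
  let ?y = "\<lambda>i. x (N - i)"
  have "gp (?y (N - Suc a)) (?y 0) (?y (Suc (N - Suc a))) \<le> c + D"
  proof (rule local_to_global_step[where N = N and L = L])
    fix i assume i: "i < N"
    then have "Suc (N - Suc i) = N - i"
      by simp
    then show "L \<le> d (?y i) (?y (Suc i))"
      using assms(1)[of "N - Suc i"] i d_commute by simp
  next
    fix i assume i: "Suc i < N"
    then have "Suc (N - Suc (Suc i)) = N - Suc i" "Suc (N - Suc i) = N - i"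
      by auto
    then show "gp (?y (Suc i)) (?y i) (?y (Suc (Suc i))) \<le> c"
      using assms(2)[of "N - Suc (Suc i)"] i gp_commute by simp
  qed (use assms(3) L a in auto)
  then have "gp (x (Suc a)) (x N) (x a) \<le> c + D"
    using a by (simp add: Suc_diff_Suc)
  then have "c + 2 * D < gp (x a) (x N) (x (Suc a))"
    using assms(1)[OF a] assms(4) d_commute unfolding gp_def by (smt (verit))
  then show ?thesis
    using 1 gp_min[of "x a" "x 0" "x N" "x (Suc a)"] by linarith
qed

text \<open>\<open>p\<close> is the branching point of the tripod spanned by \<open>x\<close>,
  \<open>y\<close> and \<open>u\<close>, placed on the geodesic from \<open>x\<close> to
  \<open>y\<close>; the 1 pays for rounding a half-integer.\<close>

lemma near_geodesic_point:
  assumes "d x p + d p y = d x y" "2 * d x p \<le> gp x u y" "gp x u y \<le> 2 * d x p + 1"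
  shows "2 * d u p \<le> gp u x y + 1 + 2 * D"
  using assms four_point[of u p x y] d_commute unfolding gp_def by (smt (verit))

text \<open>The edge is the one where the distance from \<open>x 0\<close> passes the branching
  point of the tripod spanned by \<open>x 0\<close>, \<open>x N\<close> and \<open>u\<close>, that
  is, where its double passes \<open>gp (x 0) u (x N)\<close>.\<close>

lemma projection_to_chain:
  assumes "0 < N" and "\<And>b. b \<le> N \<Longrightarrow> gp (x b) (x 0) (x N) \<le> c"
  shows "\<exists>b<N. gp u (x b) (x (Suc b)) \<le> gp u (x 0) (x N) + 3 * c + 2 * D"
proof -
  let ?T = "gp (x 0) u (x N)"
  have TN: "?T \<le> 2 * d (x 0) (x N)"
    using d_triangle[of u "x 0" "x N"] d_triangle[of "x 0" u "x N"] d_commute[of u] d_commute[of "x N" "x 0"]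
    unfolding gp_def by (smt (verit) d_commute d_triangle)
  define m where "m = (LEAST m. ?T \<le> 2 * d (x 0) (x m))"
  have m: "?T \<le> 2 * d (x 0) (x m)" "m \<le> N"
    unfolding m_def using TN by (auto intro: LeastI Least_le)
  have least: "2 * d (x 0) (x b) < ?T" if "b < m" for b
    using not_less_Least[OF that[unfolded m_def]] by simp
  obtain b where b: "b < N" "2 * d (x 0) (x b) \<le> ?T" "?T \<le> 2 * d (x 0) (x (Suc b))"
  proof (cases m)
    case 0
    then show thesis
      using that[of 0] m gp_nonneg[of "x 0" u "x N"] \<open>0 < N\<close> by simp
  next
    case (Suc b)
    then show thesis
      using that[of b] m least[of b] by simp
  qed
  have "gp (x b) (x 0) (x N) \<le> c" "gp (x (Suc b)) (x 0) (x N) \<le> c"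
    using assms(2)[of b] assms(2)[of "Suc b"] b(1) by auto
  then have "gp u (x b) (x (Suc b)) \<le> gp u (x 0) (x N) + 3 * c + 2 * D"
    using b(2,3) four_point[of u "x b" "x 0" "x N"] four_point[of u "x (Suc b)" "x N" "x 0"]
      d_triangle[of "x 0" "x N" "x b"] d_triangle[of "x b" "x N" "x (Suc b)"]
      gp_nonneg[of "x b" "x 0" "x N"]
    unfolding gp_def by (smt (verit) d_commute)
  then show ?thesis
    using b(1) by blast
qed

text \<open>If two centres of a set of circumradius \<open>r\<close> were far apart, their midpoint
  would be closer than \<open>r\<close> to every point of the set.\<close>

lemma centre_close:
  assumes "\<And>s. s \<in> S \<Longrightarrow> d c1 s \<le> r" "\<And>s. s \<in> S \<Longrightarrow> d c2 s \<le> r"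
    and "\<And>p. \<exists>s\<in>S. r \<le> d p s"
  shows "d c1 c2 \<le> 2 * D + 1"
proof -
  define t where "t = d c1 c2 div 2"
  have t: "0 \<le> t" "2 * t \<le> d c1 c2" "d c1 c2 \<le> 2 * t + 1"
    unfolding t_def using d_nonneg[of c1 c2] by linarith+
  have "t \<le> d c1 c2" using t by linarith
  then obtain p where p: "d c1 p = t" "d p c2 = d c1 c2 - t"
    using d_interp[of t c1 c2] t by auto
  obtain s where s: "s \<in> S" "r \<le> d p s"
    using assms(3) by blast
  show ?thesis
    using s(2) p t assms(1)[OF s(1)] assms(2)[OF s(1)] four_point[of s p c1 c2]
    by (smt (verit) d_commute)
qed

end

section \<open>Words, lengths and the word metric\<close>

lemma list_mult_Nil [simp]: "list_mult G [] = \<one>\<^bsub>G\<^esub>"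
  and list_mult_Cons [simp]: "list_mult G (x # xs) = x \<otimes>\<^bsub>G\<^esub> list_mult G xs"
  by (simp_all add: list_mult_def)

lemma (in group) list_mult_closed [simp]: "set xs \<subseteq> carrier G \<Longrightarrow> list_mult G xs \<in> carrier G"
  by (induction xs) auto

lemma (in group) list_mult_append:
  "set xs \<subseteq> carrier G \<Longrightarrow> set ys \<subseteq> carrier G \<Longrightarrow>
    list_mult G (xs @ ys) = list_mult G xs \<otimes> list_mult G ys"
  by (induction xs) (auto simp: m_assoc)

lemma (in group) inv_cancel_left [simp]:
  assumes "x \<in> carrier G" "y \<in> carrier G"
  shows "inv x \<otimes> (x \<otimes> y) = y" and "x \<otimes> (inv x \<otimes> y) = y"
  using assms by (simp_all add: m_assoc[symmetric])

primrec trail :: "('a, 'b) monoid_scheme \<Rightarrow> 'a \<Rightarrow> 'a list \<Rightarrow> 'a list" where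
  "trail G u [] = [u]"
| "trail G u (x # ws) = u # trail G (u \<otimes>\<^bsub>G\<^esub> x) ws"

lemma length_trail [simp]: "length (trail G u ws) = Suc (length ws)"
  by (induction ws arbitrary: u) auto

lemma trail_not_Nil [simp]: "trail G u ws \<noteq> []"
  by (cases ws) auto

lemma nth_trail_0 [simp]: "trail G u ws ! 0 = u"
  by (cases ws) auto

lemma hd_trail [simp]: "hd (trail G u ws) = u"
  by (cases ws) auto

locale finitely_generated_group = group G for G (structure) +
  fixes Y
  assumes fin_gen: "finite_generating_set G Y"
begin

abbreviation "len \<equiv> word_length G Y"

lemma letters_closed: "letters G Y \<subseteq> carrier G"
  using fin_gen by (auto simp: letters_def finite_generating_set_def)

lemma finite_letters: "finite (letters G Y)"
  using fin_gen by (auto simp: letters_def finite_generating_set_def)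

lemma letter_inv: "x \<in> letters G Y \<Longrightarrow> inv x \<in> letters G Y"
  using fin_gen by (auto simp: letters_def finite_generating_set_def subset_iff)

lemma words_closed: "set ws \<subseteq> letters G Y \<Longrightarrow> set ws \<subseteq> carrier G"
  using letters_closed by blast

lemma word_exists:
  assumes "h \<in> carrier G"
  shows "\<exists>ws. set ws \<subseteq> letters G Y \<and> list_mult G ws = h"
proof -
  have "h \<in> generate G Y"
    using assms fin_gen by (simp add: finite_generating_set_def)
  then show ?thesis
  proof induction
    case one
    show ?case by (rule exI[of _ "[]"]) simp
  next
    case (incl h)
    then show ?case
      using fin_gen by (intro exI[of _ "[h]"]) (auto simp: letters_def finite_generating_set_def)
  next
    case (inv h)
    then show ?case
      using fin_gen
      by (intro exI[of _ "[inv h]"]) (auto simp: letters_def finite_generating_set_def)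
  next
    case (eng h1 h2)
    then obtain ws1 ws2 where "set ws1 \<subseteq> letters G Y" "list_mult G ws1 = h1"
      "set ws2 \<subseteq> letters G Y" "list_mult G ws2 = h2"
      by blast
    then show ?case
      by (intro exI[of _ "ws1 @ ws2"]) (auto simp: list_mult_append words_closed)
  qed
qed

lemma shortest_word:
  assumes "h \<in> carrier G"
  obtains ws where "length ws = len h" "set ws \<subseteq> letters G Y" "list_mult G ws = h"
proof -
  have "\<exists>n ws. length ws = n \<and> set ws \<subseteq> letters G Y \<and> list_mult G ws = h"
    using word_exists[OF assms] by blast
  from LeastI_ex[OF this] show thesis
    unfolding word_length_def[symmetric] using that by blast
qed

lemma len_le: "set ws \<subseteq> letters G Y \<Longrightarrow> len (list_mult G ws) \<le> length ws"
  unfolding word_length_def by (rule Least_le) blast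

lemma len_one [simp]: "len \<one> = 0"
  using len_le[of "[]"] by simp

lemma len_mult:
  assumes "g \<in> carrier G" "h \<in> carrier G"
  shows "len (g \<otimes> h) \<le> len g + len h"
proof -
  obtain ws where ws: "length ws = len g" "set ws \<subseteq> letters G Y" "list_mult G ws = g"
    using assms(1) by (rule shortest_word)
  obtain ws' where ws': "length ws' = len h" "set ws' \<subseteq> letters G Y" "list_mult G ws' = h"
    using assms(2) by (rule shortest_word)
  show ?thesis
    using len_le[of "ws @ ws'"] ws ws' words_closed by (simp add: list_mult_append)
qed

lemma list_mult_rev_inv:
  "set ws \<subseteq> carrier G \<Longrightarrow> list_mult G (rev (map (\<lambda>x. inv x) ws)) = inv (list_mult G ws)"
proof (induction ws)
  case (Cons x ws)
  then have "set (rev (map (\<lambda>x. inv x) ws)) \<subseteq> carrier G"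
    by auto
  then show ?case
    using Cons list_mult_append[of "rev (map (\<lambda>x. inv x) ws)" "[inv x]"]
    by (simp add: inv_mult_group)
qed simp

lemma len_inv_le:
  assumes "h \<in> carrier G"
  shows "len (inv h) \<le> len h"
proof -
  obtain ws where ws: "length ws = len h" "set ws \<subseteq> letters G Y" "list_mult G ws = h"
    using assms by (rule shortest_word)
  then have "set (rev (map (\<lambda>x. inv x) ws)) \<subseteq> letters G Y"
    using letter_inv by auto
  from len_le[OF this] show ?thesis
    using ws list_mult_rev_inv[OF words_closed[OF ws(2)]] by simp
qed

lemma len_inv [simp]: "h \<in> carrier G \<Longrightarrow> len (inv h) = len h"
  using len_inv_le[of h] len_inv_le[of "inv h"] by simp

lemma len_eq_0: "h \<in> carrier G \<Longrightarrow> len h = 0 \<Longrightarrow> h = \<one>"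
  by (metis length_0_conv list_mult_Nil shortest_word)

lemma len_pow: "h \<in> carrier G \<Longrightarrow> len (h [^] (n :: nat)) \<le> n * len h"
proof (induction n)
  case (Suc n)
  have "len (h [^] Suc n) \<le> len (h [^] n) + len h"
    using Suc.prems by (simp add: len_mult)
  then show ?case
    using Suc by auto
qed simp

lemma len_int_pow:
  assumes "h \<in> carrier G"
  shows "len (h [^] (n :: int)) \<le> nat \<bar>n\<bar> * len h"
proof (cases n rule: int_cases2)
  case (nonneg m)
  then show ?thesis
    using len_pow[OF assms, of m] by (simp add: int_pow_int)
next
  case (nonpos m)
  then show ?thesis
    using len_pow[OF assms, of m] assms by (simp add: int_pow_neg_int)
qed

definition ball :: "nat \<Rightarrow> 'a set" where
  "ball r = {h \<in> carrier G. len h \<le> r}"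

text \<open>Padding with units lets all words have length exactly \<open>r\<close>, so that counting
  words bounds the ball by a single power.\<close>

lemma ball_subset:
  "ball r \<subseteq> list_mult G ` {ws. set ws \<subseteq> insert \<one> (letters G Y) \<and> length ws = r}"
proof
  fix h assume "h \<in> ball r"
  then have h: "h \<in> carrier G" "len h \<le> r"
    by (auto simp: ball_def)
  from h(1) obtain ws where ws: "length ws = len h" "set ws \<subseteq> letters G Y" "list_mult G ws = h"
    by (rule shortest_word)
  have "list_mult G (replicate n \<one>) = \<one>" for n
    by (induction n) auto
  then have "list_mult G (ws @ replicate (r - len h) \<one>) = h"
    using ws words_closed h by (subst list_mult_append) auto
  then show "h \<in> list_mult G ` {ws. set ws \<subseteq> insert \<one> (letters G Y) \<and> length ws = r}"
    using ws h by (intro image_eqI[of _ _ "ws @ replicate (r - len h) \<one>"]) (auto simp: subset_iff)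
qed

lemma finite_ball: "finite (ball r)"
  by (rule finite_subset[OF ball_subset]) (simp add: finite_letters finite_lists_length_eq)

lemma card_ball: "card (ball r) \<le> card (insert \<one> (letters G Y)) ^ r"
proof -
  let ?W = "{ws. set ws \<subseteq> insert \<one> (letters G Y) \<and> length ws = r}"
  have "finite ?W"
    by (simp add: finite_letters finite_lists_length_eq)
  then have "card (ball r) \<le> card (list_mult G ` ?W)"
    by (intro card_mono ball_subset finite_imageI)
  also have "\<dots> \<le> card ?W"
    by (rule card_image_le) fact
  also have "\<dots> = card (insert \<one> (letters G Y)) ^ r"
    by (rule card_lists_length_eq) (simp add: finite_letters)
  finally show ?thesis .
qed

text \<open>Elements outside the carrier are identified with the unit, which makes the word metric
  a pseudo-metric on the whole type.\<close>

definition dist :: "'a \<Rightarrow> 'a \<Rightarrow> int" where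
  "dist x y = int (word_dist G Y (if x \<in> carrier G then x else \<one>) (if y \<in> carrier G then y else \<one>))"

lemma dist_eq: "x \<in> carrier G \<Longrightarrow> y \<in> carrier G \<Longrightarrow> dist x y = int (len (inv x \<otimes> y))"
  by (simp add: dist_def word_dist_def)

lemma dist_carrier_rep:
  "\<exists>x'\<in>carrier G. (\<forall>y. dist x y = dist x' y) \<and> (\<forall>y. dist y x = dist y x')"
  by (rule bexI[of _ "if x \<in> carrier G then x else \<one>"]) (auto simp: dist_def)

lemma dist_left_mult:
  "g \<in> carrier G \<Longrightarrow> x \<in> carrier G \<Longrightarrow> y \<in> carrier G \<Longrightarrow> dist (g \<otimes> x) (g \<otimes> y) = dist x y"
  by (simp add: dist_eq inv_mult_group m_assoc)

lemma dist_right_mult: "x \<in> carrier G \<Longrightarrow> g \<in> carrier G \<Longrightarrow> dist x (x \<otimes> g) = int (len g)"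
  by (simp add: dist_eq m_assoc[symmetric])

lemma dist_sym: "dist x y = dist y x"
proof -
  obtain x' where x': "x' \<in> carrier G" "\<And>y. dist x y = dist x' y" "\<And>y. dist y x = dist y x'"
    using dist_carrier_rep[of x] by blast
  obtain y' where y': "y' \<in> carrier G" "\<And>z. dist y z = dist y' z" "\<And>z. dist z y = dist z y'"
    using dist_carrier_rep[of y] by blast
  have "inv y' \<otimes> x' = inv (inv x' \<otimes> y')"
    using x' y' by (simp add: inv_mult_group)
  then show ?thesis
    using x' y' by (simp add: dist_eq)
qed

lemma dist_tri: "dist x z \<le> dist x y + dist y z"
proof -
  obtain x' where x': "x' \<in> carrier G" "\<And>y. dist x y = dist x' y" "\<And>y. dist y x = dist y x'"
    using dist_carrier_rep[of x] by blast
  obtain y' where y': "y' \<in> carrier G" "\<And>z. dist y z = dist y' z" "\<And>z. dist z y = dist z y'"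
    using dist_carrier_rep[of y] by blast
  obtain z' where z': "z' \<in> carrier G" "\<And>y. dist z y = dist z' y" "\<And>y. dist y z = dist y z'"
    using dist_carrier_rep[of z] by blast
  have "inv x' \<otimes> z' = (inv x' \<otimes> y') \<otimes> (inv y' \<otimes> z')"
    using x' y' z' by (simp add: m_assoc)
  then show ?thesis
    using x' y' z' len_mult[of "inv x' \<otimes> y'" "inv y' \<otimes> z'"] by (simp add: dist_eq)
qed

text \<open>Cut a shortest word for the displacement after \<open>t\<close> letters. Both pieces are
  bounded by their numbers of letters, and the triangle inequality leaves no slack.\<close>

lemma dist_interp:
  assumes "x \<in> carrier G" "y \<in> carrier G" "0 \<le> t" "t \<le> dist x y"
  shows "\<exists>p\<in>carrier G. dist x p = t \<and> dist p y = dist x y - t"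
proof -
  obtain ws where ws: "length ws = len (inv x \<otimes> y)" "set ws \<subseteq> letters G Y"
    "list_mult G ws = inv x \<otimes> y"
    using assms shortest_word[of "inv x \<otimes> y"] by auto
  let ?a = "list_mult G (take (nat t) ws)" and ?b = "list_mult G (drop (nat t) ws)"
  have sub: "set (take (nat t) ws) \<subseteq> letters G Y" "set (drop (nat t) ws) \<subseteq> letters G Y"
    using ws(2) by (meson order_trans set_take_subset set_drop_subset)+
  have car: "?a \<in> carrier G" "?b \<in> carrier G"
    using sub words_closed by auto
  have "?a \<otimes> ?b = inv x \<otimes> y"
    using ws(3) sub words_closed by (subst list_mult_append[symmetric]) auto
  then have y: "y = x \<otimes> ?a \<otimes> ?b"
    using assms car by (metis inv_solve_left m_assoc m_closed)
  have "dist x (x \<otimes> ?a) \<le> t"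
    using len_le[OF sub(1)] assms car by (auto simp: dist_right_mult le_nat_iff)
  moreover have "dist (x \<otimes> ?a) y \<le> dist x y - t"
    using len_le[OF sub(2)] assms car ws(1) by (subst y) (simp add: dist_right_mult dist_eq)
  moreover have "dist x y \<le> dist x (x \<otimes> ?a) + dist (x \<otimes> ?a) y"
    by (rule dist_tri)
  ultimately have "dist x (x \<otimes> ?a) = t" "dist (x \<otimes> ?a) y = dist x y - t"
    by linarith+
  then show ?thesis
    using assms(1) car(1) by blast
qed

sublocale geodesic_dist dist
proof
  fix x y z :: 'a and t :: int
  show "dist x x = 0"
    by (simp add: dist_def word_dist_def)
  show "dist x y = dist y x"
    by (rule dist_sym)
  show "dist x z \<le> dist x y + dist y z"
    by (rule dist_tri)
  obtain x' where x': "x' \<in> carrier G" "\<And>y. dist x y = dist x' y" "\<And>y. dist y x = dist y x'"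
    using dist_carrier_rep[of x] by blast
  obtain y' where y': "y' \<in> carrier G" "\<And>z. dist y z = dist y' z" "\<And>z. dist z y = dist z y'"
    using dist_carrier_rep[of y] by blast
  assume "0 \<le> t" "t \<le> dist x y"
  then show "\<exists>p. dist x p = t \<and> dist p y = dist x y - t"
    using dist_interp[OF x'(1) y'(1), of t] x' y' by auto
qed

lemma set_trail:
  "u \<in> carrier G \<Longrightarrow> set ws \<subseteq> letters G Y \<Longrightarrow> set (trail G u ws) \<subseteq> carrier G"
  using letters_closed by (induction ws arbitrary: u) auto

lemma last_trail:
  "u \<in> carrier G \<Longrightarrow> set ws \<subseteq> letters G Y \<Longrightarrow> last (trail G u ws) = u \<otimes> list_mult G ws"
proof (induction ws arbitrary: u)
  case (Cons x ws)
  have "x \<in> carrier G" "list_mult G ws \<in> carrier G"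
    using Cons.prems letters_closed words_closed by auto
  then show ?case
    using Cons by (simp add: m_assoc)
qed simp

lemma trail_append_mem:
  "u \<in> carrier G \<Longrightarrow> set ws \<subseteq> letters G Y \<Longrightarrow> u \<otimes> list_mult G ws \<in> set (trail G u (ws @ ws'))"
proof (induction ws arbitrary: u)
  case Nil
  then show ?case
    by (cases ws') auto
next
  case (Cons x ws)
  have "x \<in> carrier G" "list_mult G ws \<in> carrier G"
    using Cons.prems letters_closed words_closed by auto
  then show ?case
    using Cons.IH[of "u \<otimes> x"] Cons.prems by (simp add: m_assoc)
qed

lemma trail_path:
  assumes "u \<in> carrier G" "set ws \<subseteq> letters G Y"
  shows "cayley_path G Y (trail G u ws)"
proof -
  have "\<exists>x\<in>letters G Y. trail G u ws ! Suc i = trail G u ws ! i \<otimes> x" if "i < length ws" for i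
    using that assms(2)
  proof (induction ws arbitrary: u i)
    case (Cons x ws)
    show ?case
    proof (cases i)
      case 0
      then show ?thesis
        using Cons.prems by (intro bexI[of _ x]) auto
    qed (use Cons in auto)
  qed simp
  then show ?thesis
    using set_trail[OF assms] by (auto simp: cayley_path_def)
qed

lemma geodesic_through:
  assumes "u \<in> carrier G" "p \<in> carrier G" "v \<in> carrier G" "dist u p + dist p v = dist u v"
  obtains vs where "cayley_geodesic G Y u v vs" "p \<in> set vs"
proof -
  obtain ws1 where 1: "length ws1 = len (inv u \<otimes> p)" "set ws1 \<subseteq> letters G Y"
    "list_mult G ws1 = inv u \<otimes> p"
    using assms shortest_word[of "inv u \<otimes> p"] by auto
  obtain ws2 where 2: "length ws2 = len (inv p \<otimes> v)" "set ws2 \<subseteq> letters G Y"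
    "list_mult G ws2 = inv p \<otimes> v"
    using assms shortest_word[of "inv p \<otimes> v"] by auto
  have p: "u \<otimes> list_mult G ws1 = p"
    using 1 assms by (simp add: m_assoc[symmetric])
  have "list_mult G (ws1 @ ws2) = inv u \<otimes> v"
    using 1 2 assms words_closed by (simp add: list_mult_append m_assoc)
  then have "u \<otimes> list_mult G (ws1 @ ws2) = v"
    using assms by (simp add: m_assoc[symmetric])
  moreover have "length (ws1 @ ws2) = word_dist G Y u v"
    using 1(1) 2(1) assms by (simp add: dist_eq word_dist_def)
  ultimately have "cayley_geodesic G Y u v (trail G u (ws1 @ ws2))"
    unfolding cayley_geodesic_def using 1 2 assms by (auto simp: trail_path last_trail)
  moreover have "p \<in> set (trail G u (ws1 @ ws2))"
    using trail_append_mem[OF assms(1) 1(2)] p by simp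
  ultimately show thesis
    by (rule that)
qed

lemma path_dist:
  assumes "cayley_path G Y vs" "i \<le> j" "j < length vs"
  shows "dist (vs ! i) (vs ! j) \<le> int (j - i)"
  using assms(2,3)
proof (induction j)
  case (Suc j)
  show ?case
  proof (cases "i = Suc j")
    case False
    obtain x where x: "x \<in> letters G Y" "vs ! Suc j = vs ! j \<otimes> x"
      using assms(1) Suc.prems by (auto simp: cayley_path_def)
    have "vs ! j \<in> carrier G"
      using assms(1) Suc.prems by (auto simp: cayley_path_def)
    moreover have "len x \<le> 1"
      using len_le[of "[x]"] x(1) letters_closed by (auto simp: subset_iff)
    ultimately have "dist (vs ! j) (vs ! Suc j) \<le> 1"
      using x letters_closed by (auto simp: dist_right_mult)
    moreover have "dist (vs ! i) (vs ! j) \<le> int (j - i)"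
      using Suc False by auto
    ultimately show ?thesis
      using d_triangle[of "vs ! i" "vs ! Suc j" "vs ! j"] False Suc.prems by simp
  qed simp
qed simp

text \<open>The two parts of the vertex list bound the two distances from above, and these bounds
  add up to \<open>dist u v\<close>. Together with \<open>geodesic_through\<close> this turns
  slimness of vertex lists into the metric condition of \<open>slim_imp_four_point\<close>.\<close>

lemma geodesic_point:
  assumes "cayley_geodesic G Y u v vs" "b \<in> set vs"
  shows "b \<in> carrier G" "dist u b + dist b v = dist u v"
proof -
  have vs: "cayley_path G Y vs" "vs \<noteq> []" "u = vs ! 0" "v = vs ! (length vs - 1)"
    "length vs = Suc (word_dist G Y u v)"
    using assms(1) hd_conv_nth[of vs] last_conv_nth[of vs]
    unfolding cayley_geodesic_def cayley_path_def by metis+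
  have car: "set vs \<subseteq> carrier G"
    using vs(1) by (simp add: cayley_path_def)
  then show "b \<in> carrier G"
    using assms(2) by blast
  obtain i where i: "i < length vs" "b = vs ! i"
    using assms(2) by (metis in_set_conv_nth)
  have "u \<in> carrier G" "v \<in> carrier G"
    using car vs(2,3,4) by (auto simp: subset_iff)
  then have "dist u v = int (length vs) - 1"
    using vs(5) by (simp add: dist_eq word_dist_def)
  moreover have "dist u b \<le> int i"
    using path_dist[OF vs(1), of 0 i] i vs(3) by simp
  moreover have "dist b v \<le> int (length vs - 1 - i)"
    unfolding i(2) by (subst vs(4), rule path_dist[OF vs(1)]) (use i in auto)
  ultimately show "dist u b + dist b v = dist u v"
    using d_triangle[of u v b] i(1) by linarith
qed

lemma slim_imp_hyperbolic:
  assumes "slim_triangles G Y \<delta>"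
  shows "\<exists>D. hyperbolic_dist dist D"
proof -
  have "\<exists>b. (dist v b + dist b w = dist v w \<or> dist w b + dist b u = dist w u) \<and> dist p b \<le> \<lceil>\<delta>\<rceil>"
    if "dist u p + dist p v = dist u v" for u v w p
  proof -
    obtain u' where u': "u' \<in> carrier G" "\<And>y. dist u y = dist u' y" "\<And>y. dist y u = dist y u'"
      using dist_carrier_rep[of u] by blast
    obtain v' where v': "v' \<in> carrier G" "\<And>y. dist v y = dist v' y" "\<And>y. dist y v = dist y v'"
      using dist_carrier_rep[of v] by blast
    obtain w' where w': "w' \<in> carrier G" "\<And>y. dist w y = dist w' y" "\<And>y. dist y w = dist y w'"
      using dist_carrier_rep[of w] by blast
    obtain p' where p': "p' \<in> carrier G" "\<And>y. dist p y = dist p' y" "\<And>y. dist y p = dist y p'"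
      using dist_carrier_rep[of p] by blast
    have "dist u' p' + dist p' v' = dist u' v'"
      using that u' v' p' by simp
    then obtain P where P: "cayley_geodesic G Y u' v' P" "p' \<in> set P"
      using geodesic_through u'(1) v'(1) p'(1) by blast
    obtain Q where Q: "cayley_geodesic G Y v' w' Q"
      using geodesic_through[of v' v' w'] v'(1) w'(1) by auto
    obtain R where R: "cayley_geodesic G Y w' u' R"
      using geodesic_through[of w' w' u'] u'(1) w'(1) by auto
    obtain b where b: "b \<in> set Q \<union> set R" "real (word_dist G Y p' b) \<le> \<delta>"
      using assms P Q R unfolding slim_triangles_def by blast
    have "b \<in> carrier G"
      using b(1) geodesic_point(1)[OF Q] geodesic_point(1)[OF R] by blast
    then have "dist p' b \<le> \<lceil>\<delta>\<rceil>"
      using b(2) p'(1) by (simp add: dist_def le_ceiling_iff)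
    then show ?thesis
      using b(1) geodesic_point(2)[OF Q, of b] geodesic_point(2)[OF R, of b] u'(2,3) v'(2,3) w'(2,3) p'(2,3)
        \<open>dist p' b \<le> \<lceil>\<delta>\<rceil>\<close>
      by (intro exI[of _ b]) auto
  qed
  then have "hyperbolic_dist dist (6 * \<lceil>\<delta>\<rceil> + 2)"
    by unfold_locales (rule slim_imp_four_point)
  then show ?thesis ..
qed

end

section \<open>Elements acting as translations\<close>

context hyperbolic_dist
begin

text \<open>The points \<open>fo\<close>, \<open>fz\<close>, \<open>fe\<close> and \<open>f2z\<close> stand for the images of \<open>o'\<close>, \<open>z\<close>, \<open>e\<close> and \<open>fz\<close> under
  an isometry \<open>f\<close> that moves the end points of the geodesic from \<open>o'\<close> to \<open>e\<close> much less than its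
  length, so that \<open>f\<close> acts near the interior point \<open>z\<close> like a translation along that geodesic.\<close>

lemma translation_near_midpoint:
  assumes "d o' z = T" "d z e = E - T" "d o' e = E"
    and "d fo fz = T" "d fz fe = E - T" "d fo fe = E"
    and "d fo f2z = d o' fz" "d fz f2z = d z fz"
    and m: "d o' fo \<le> m" "d e fe \<le> m" and T: "2 * m + 2 * D < T" "T \<le> E - T"
  shows "2 * d z fz - d z f2z \<le> 7 * D"
proof -
  have D0: "0 \<le> D"
    by (rule D_nonneg)
  have m0: "0 \<le> m"
    using m(1) d_nonneg[of o' fo] by linarith
  have "D < gp fz fo o'"
    using d_triangle[of fo fz o'] assms m0 D0 d_commute unfolding gp_def by (smt (verit))
  then have "gp fz o' fe \<le> D"
    using gp_min[of fz fo o' fe] assms d_commute unfolding gp_def by (smt (verit))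
  moreover have "2 * D < gp fz e fe"
    using d_triangle[of fz fe e] assms m0 D0 d_commute unfolding gp_def by (smt (verit))
  ultimately have near: "gp fz o' e \<le> 2 * D"
    using gp_min[of fz o' e fe] by linarith
  \<comment> \<open>\<open>s\<close> is the signed amount of the shift along the geodesic. Up to
    multiples of \<open>D\<close>, \<open>z\<close> moves by at most \<open>\<bar>s\<bar>\<close>
    under the map and by at least twice that under its square; the errors \<open>2 * (3 * D)\<close>
    and \<open>D\<close> add up to \<open>7 * D\<close>.\<close>
  define s where "s = d o' fz - T"
  have s: "- m \<le> s" "s \<le> m"
    using d_triangle[of o' fz fo] d_triangle[of fo fz o'] assms d_commute unfolding s_def by (smt (verit))+
  have 1: "d z fz \<le> \<bar>s\<bar> + 3 * D"
    using four_point[of z fz o' e] near assms D0 d_commute unfolding gp_def s_def by (smt (verit))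
  have 2: "T + 2 * s - D \<le> d o' f2z" "d o' f2z \<le> T + 2 * s + D"
    using four_point[of o' fz fo f2z] four_point[of o' f2z fo fz] 1 s assms D0 d_commute
    unfolding s_def by (smt (verit))+
  have "d o' f2z - T \<le> d z f2z" "T - d o' f2z \<le> d z f2z"
    using d_triangle[of o' f2z z] d_triangle[of o' z f2z] assms(1) d_commute by (smt (verit))+
  then show ?thesis
    using 1 2 by linarith
qed

end

locale word_hyperbolic_group = finitely_generated_group G Y for G (structure) and Y +
  fixes D :: int
  assumes hyperbolic: "hyperbolic_dist dist D"
begin

sublocale hyperbolic_dist dist D
  by (rule hyperbolic)

text \<open>The radius is the edge length used for the local-to-global principle with
  \<open>c = 7 * D\<close>, which requires \<open>17 * D < 2 * L\<close>.\<close>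

definition order_bound :: nat where
  "order_bound = card (ball (nat (10 * D + 1)))"

text \<open>Pigeonhole: the exponents from 0 to \<open>order_bound\<close> are one more than the
  elements of the ball, so two conjugated powers agree.\<close>

lemma conj_powers_in_ball_imp_torsion:
  assumes "w \<in> carrier G" "z \<in> carrier G"
    and "\<And>j. 1 \<le> j \<Longrightarrow> j \<le> order_bound \<Longrightarrow> dist z (w [^] j \<otimes> z) \<le> 10 * D + 1"
  shows "\<exists>j::nat. 1 \<le> j \<and> j \<le> order_bound \<and> w [^] j = \<one>"
proof -
  let ?B = "ball (nat (10 * D + 1))"
  let ?f = "\<lambda>j::nat. inv z \<otimes> (w [^] j \<otimes> z)"
  have "?f ` {0..order_bound} \<subseteq> ?B"
  proof
    fix h assume "h \<in> ?f ` {0..order_bound}"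
    then obtain j where j: "h = ?f j" "j \<le> order_bound"
      by auto
    have "dist z (w [^] j \<otimes> z) \<le> 10 * D + 1"
      using assms j(2) D_nonneg by (cases "j = 0") auto
    then show "h \<in> ?B"
      using assms(1,2) j by (simp add: ball_def dist_eq le_nat_iff)
  qed
  then have "card (?f ` {0..order_bound}) \<le> order_bound"
    unfolding order_bound_def by (rule card_mono[OF finite_ball])
  then have "\<not> inj_on ?f {0..order_bound}"
    by (auto dest!: card_image)
  then obtain i j where ij: "i < j" "j \<le> order_bound" "?f i = ?f j"
    unfolding inj_on_def by (metis atLeastAtMost_iff linorder_neqE_nat)
  then have "w [^] i = w [^] j"
    using assms(1,2) by (metis inv_cancel_left(2) m_closed nat_pow_closed right_cancel)
  also have "\<dots> = w [^] i \<otimes> w [^] (j - i)"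
    using assms(1) ij(1) by (simp add: nat_pow_mult)
  finally have "w [^] (j - i) = \<one>"
    using assms(1) by (metis l_cancel_one' nat_pow_closed)
  then show ?thesis
    using ij by (intro exI[of _ "j - i"]) auto
qed

text \<open>Let \<open>z\<close> be the centre of a smallest ball containing all powers of
  \<open>w\<close>. Both \<open>z\<close> and \<open>w [^] j \<otimes> z\<close> are centres of the
  tail of the orbit from exponent \<open>j\<close> on, whose circumradius is the same; hence they
  are close for every \<open>j\<close>.\<close>

lemma bounded_orbit_imp_torsion:
  assumes w: "w \<in> carrier G" and bd: "\<And>n::nat. len (w [^] n) \<le> B"
  shows "\<exists>j::nat. 1 \<le> j \<and> j \<le> order_bound \<and> w [^] j = \<one>"
proof -
  let ?P = "\<lambda>r. \<exists>p\<in>carrier G. \<forall>n::nat. dist p (w [^] n) \<le> int r"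
  have "?P B"
    using w bd by (intro bexI[of _ \<one>]) (auto simp: dist_eq)
  define r where "r = (LEAST r. ?P r)"
  have "?P r"
    unfolding r_def using \<open>?P B\<close> by (rule LeastI)
  then obtain z where z: "z \<in> carrier G" "\<And>n::nat. dist z (w [^] n) \<le> int r"
    by blast
  have "dist z (w [^] j \<otimes> z) \<le> 2 * D + 1" for j :: nat
  proof (rule centre_close[where S = "range (\<lambda>n. w [^] (j + n))" and r = "int r"])
    fix s assume "s \<in> range (\<lambda>n. w [^] (j + n))"
    then obtain n where s: "s = w [^] (j + n)"
      by blast
    then show "dist z s \<le> int r"
      using z by blast
    have "s = w [^] j \<otimes> w [^] n"
      using s w by (simp add: nat_pow_mult)
    then show "dist (w [^] j \<otimes> z) s \<le> int r"
      using z w by (simp add: dist_left_mult)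
  next
    fix p
    obtain p' where p': "p' \<in> carrier G" "\<And>y. dist p y = dist p' y"
      using dist_carrier_rep[of p] by blast
    show "\<exists>s\<in>range (\<lambda>n. w [^] (j + n)). int r \<le> dist p s"
    proof (rule ccontr)
      assume "\<not> ?thesis"
      then have lt: "dist p' (w [^] (j + n)) < int r" for n
        using p' by (auto simp: not_le)
      let ?q = "inv (w [^] j) \<otimes> p'"
      have "dist ?q (w [^] n) \<le> int (r - 1)" for n :: nat
      proof -
        have "dist ?q (w [^] n) = dist (w [^] j \<otimes> ?q) (w [^] j \<otimes> w [^] n)"
          using w p' by (subst dist_left_mult) auto
        also have "\<dots> = dist p' (w [^] (j + n))"
          using w p' by (simp add: nat_pow_mult)
        finally show ?thesis
          using lt[of n] by linarith
      qed
      \<comment> \<open>Subtraction is truncated, so the case \<open>r = 0\<close> survives here and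
        is refuted by nonnegativity of the distance.\<close>
      then have "?P (r - 1)"
        using w p' by (intro bexI[of _ ?q]) auto
      then have "r \<le> r - 1"
        unfolding r_def by (rule Least_le)
      then have "r = 0"
        by simp
      then show False
        using lt[of 0] d_nonneg[of p' "w [^] (j + 0)"] by simp
    qed
  qed
  then show ?thesis
    using D_nonneg by (intro conj_powers_in_ball_imp_torsion[OF w z(1)]) (smt (verit))
qed

text \<open>Chosen to absorb \<open>B + len w\<close> for the threshold \<open>B\<close> in the
  proof of \<open>torsion_or_translates\<close>.\<close>

definition conj_bound :: nat where
  "conj_bound = 4 * order_bound + nat (4 * D) + 3"

text \<open>The power \<open>j\<close> and the conjugator \<open>z\<close> are controlled uniformly in \<open>w\<close>; the last two inequalities
  make \<open>n \<mapsto> w [^] (j n) \<otimes> z\<close> a local quasi-geodesic, with constants depending only on \<open>G\<close>.\<close>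

definition translates :: "'a \<Rightarrow> nat \<Rightarrow> 'a \<Rightarrow> bool" where
  "translates w j z \<longleftrightarrow> 1 \<le> j \<and> j \<le> order_bound \<and> z \<in> carrier G \<and> len z \<le> conj_bound * (len w + 1) \<and>
     10 * D + 1 < dist z (w [^] j \<otimes> z) \<and>
     2 * dist z (w [^] j \<otimes> z) - dist z (w [^] (j + j) \<otimes> z) \<le> 7 * D"

lemma torsion_or_translates:
  assumes w: "w \<in> carrier G"
  shows "(\<exists>j::nat. 1 \<le> j \<and> j \<le> order_bound \<and> w [^] j = \<one>) \<or> (\<exists>j z. translates w j z)"
proof (cases "\<exists>B. \<forall>n::nat. len (w [^] n) \<le> B")
  case True
  then show ?thesis
    using bounded_orbit_imp_torsion[OF w] by blast
next
  case False
  define m where "m = order_bound * len w"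
  \<comment> \<open>Half of \<open>B\<close> has to exceed \<open>2 * m + 2 * D\<close>, because
    \<open>m\<close> bounds the displacement of both end points of the geodesic under every
    admissible power of \<open>w\<close>.\<close>
  define B where "B = 4 * m + nat (4 * D) + 2"
  have ex: "\<exists>n::nat. B \<le> len (w [^] n)"
    using False by (meson nat_le_linear)
  \<comment> \<open>The least such exponent keeps the end point, and with it the midpoint
    \<open>z\<close>, within a distance linear in \<open>len w\<close>.\<close>
  define n where "n = (LEAST n::nat. B \<le> len (w [^] n))"
  have n: "B \<le> len (w [^] n)"
    unfolding n_def using ex by (rule LeastI_ex)
  then have "n \<noteq> 0"
    by (intro notI) (simp add: B_def)
  then obtain n' where n': "n = Suc n'"
    by (cases n) auto
  have "\<not> B \<le> len (w [^] n')"
    using not_less_Least[of n' "\<lambda>n. B \<le> len (w [^] n)"] n' unfolding n_def by auto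
  moreover have "len (w [^] n) \<le> len (w [^] n') + len w"
    using w n' len_mult[of "w [^] n'" w] by simp
  ultimately have nB: "len (w [^] n) \<le> B + len w"
    by simp
  define e where "e = w [^] n"
  have e: "e \<in> carrier G"
    using w by (simp add: e_def)
  define E where "E = dist \<one> e"
  have E: "E = int (len (w [^] n))"
    using w by (simp add: E_def e_def dist_eq)
  define T where "T = E div 2"
  have T: "0 \<le> T" "T \<le> E - T" "E \<le> 2 * T + 1" "T \<le> E"
    using E unfolding T_def by linarith+
  have T': "2 * int m + 2 * D < T"
    using T n D_nonneg unfolding E B_def by linarith
  obtain z where z: "z \<in> carrier G" "dist \<one> z = T" "dist z e = E - T"
    using dist_interp[of \<one> e T] e T unfolding E_def by auto
  have "int (len z) = T"
    using z by (simp add: dist_eq)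
  then have "len z \<le> B + len w"
    using T nB unfolding E by linarith
  also have "\<dots> \<le> conj_bound * (len w + 1)"
    unfolding B_def conj_bound_def m_def by (simp add: algebra_simps)
  finally have lenz: "len z \<le> conj_bound * (len w + 1)" .
  have main: "2 * dist z (w [^] j \<otimes> z) - dist z (w [^] (j + j) \<otimes> z) \<le> 7 * D" if j: "j \<le> order_bound" for j
  proof -
    let ?f = "w [^] j"
    have f: "?f \<in> carrier G"
      using w by simp
    have "len ?f \<le> m"
      using len_pow[OF w, of j] j unfolding m_def by (meson le_trans mult_le_mono1)
    \<comment> \<open>As powers of \<open>w\<close> commute, \<open>e\<close> is displaced by no
      more than \<open>len ?f\<close>, just like the unit.\<close>
    have "?f \<otimes> e = e \<otimes> ?f"
      using w unfolding e_def by (simp add: nat_pow_mult add.commute)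
    have 2: "w [^] (j + j) \<otimes> z = ?f \<otimes> (?f \<otimes> z)"
      using w z(1) by (simp add: nat_pow_mult[symmetric] m_assoc)
    show ?thesis
      unfolding 2
    proof (rule translation_near_midpoint[OF z(2,3) E_def[symmetric], where m = "int m"])
      show "dist (?f \<otimes> \<one>) (?f \<otimes> z) = T" "dist (?f \<otimes> z) (?f \<otimes> e) = E - T" "dist (?f \<otimes> \<one>) (?f \<otimes> e) = E"
        by (simp_all only: dist_left_mult f z e one_closed E_def[symmetric])
      show "dist (?f \<otimes> \<one>) (?f \<otimes> (?f \<otimes> z)) = dist \<one> (?f \<otimes> z)"
        "dist (?f \<otimes> z) (?f \<otimes> (?f \<otimes> z)) = dist z (?f \<otimes> z)"
        by (simp_all only: dist_left_mult f z(1) one_closed m_closed)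
      show "dist \<one> (?f \<otimes> \<one>) \<le> int m"
        using f \<open>len ?f \<le> m\<close> by (simp add: dist_eq)
      show "dist e (?f \<otimes> e) \<le> int m"
        using f e \<open>len ?f \<le> m\<close> unfolding \<open>?f \<otimes> e = e \<otimes> ?f\<close> by (simp add: dist_right_mult)
    qed (use T T' in auto)
  qed
  show ?thesis
  proof (rule ccontr)
    assume neg: "\<not> ?thesis"
    then obtain j where "1 \<le> j" "j \<le> order_bound" "10 * D + 1 < dist z (w [^] j \<otimes> z)"
      using conj_powers_in_ball_imp_torsion[OF w z(1)] by (meson not_le)
    then show False
      using neg main[of j] z(1) lenz unfolding translates_def by blast
  qed
qed

end

section \<open>Exchanging exponents\<close>

context word_hyperbolic_group
begin

lemma translates_closed: "translates w j z \<Longrightarrow> z \<in> carrier G"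
  by (simp add: translates_def)

text \<open>The signed step \<open>s\<close> lets an orbit follow either a positive or a negative
  exponent. Displacements between its points do not depend on \<open>p\<close>.\<close>

definition orbit :: "'a \<Rightarrow> 'a \<Rightarrow> int \<Rightarrow> 'a \<Rightarrow> nat \<Rightarrow> 'a" where
  "orbit p w s z a = p \<otimes> (w [^] (s * int a) \<otimes> z)"

lemma orbit_closed [simp]:
  "p \<in> carrier G \<Longrightarrow> w \<in> carrier G \<Longrightarrow> z \<in> carrier G \<Longrightarrow> orbit p w s z a \<in> carrier G"
  by (simp add: orbit_def)

lemma inv_orbit_mult_orbit:
  assumes "p \<in> carrier G" "w \<in> carrier G" "z \<in> carrier G"
  shows "inv (orbit p w s z a) \<otimes> orbit p w s z b = inv z \<otimes> (w [^] (s * (int b - int a)) \<otimes> z)"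
proof -
  have "w [^] (s * int b) = w [^] (s * int a) \<otimes> w [^] (s * (int b - int a))"
    using assms by (simp add: int_pow_mult[symmetric] algebra_simps)
  then show ?thesis
    using assms by (simp add: orbit_def inv_mult_group m_assoc)
qed

lemma dist_orbit:
  assumes "p \<in> carrier G" "w \<in> carrier G" "z \<in> carrier G"
  shows "dist (orbit p w s z a) (orbit p w s z b) = dist z (w [^] (s * (int b - int a)) \<otimes> z)"
  using assms inv_orbit_mult_orbit[OF assms, of s a b] by (simp add: dist_eq)

lemma dist_int_pow_neg:
  assumes "w \<in> carrier G" "z \<in> carrier G"
  shows "dist z (w [^] (- x :: int) \<otimes> z) = dist z (w [^] x \<otimes> z)"
proof -
  have "dist z (w [^] (- x) \<otimes> z) = dist (w [^] x \<otimes> z) (w [^] x \<otimes> (w [^] (- x) \<otimes> z))"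
    using assms by (simp add: dist_left_mult)
  also have "w [^] x \<otimes> (w [^] (- x) \<otimes> z) = z"
    using assms by (simp add: int_pow_neg)
  finally show ?thesis
    by (simp add: dist_sym)
qed

lemma dist_signed_pow:
  assumes "w \<in> carrier G" "z \<in> carrier G" "\<bar>s\<bar> = int j"
  shows "dist z (w [^] (s * int n) \<otimes> z) = dist z (w [^] (j * n) \<otimes> z)"
proof -
  have "s = int j \<or> s = - int j"
    using assms(3) by linarith
  then show ?thesis
    using dist_int_pow_neg[OF assms(1,2), of "int (j * n)"] int_pow_int[of G w "j * n"] by auto
qed

lemma orbit_local:
  assumes tr: "translates w j z" and w: "w \<in> carrier G" and p: "p \<in> carrier G" and s: "\<bar>s\<bar> = int j"
  defines "x \<equiv> orbit p w s z"
  shows "10 * D + 1 \<le> dist (x i) (x (Suc i))"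
    and "gp (x (Suc i)) (x i) (x (Suc (Suc i))) \<le> 7 * D"
proof -
  have z: "z \<in> carrier G"
    using tr by (rule translates_closed)
  have 1: "dist (x i) (x (Suc i)) = dist z (w [^] j \<otimes> z)" for i
    using dist_orbit[OF p w z, of s i "Suc i"] dist_signed_pow[OF w z s, of 1] by (simp add: x_def)
  have 2: "dist (x i) (x (Suc (Suc i))) = dist z (w [^] (j + j) \<otimes> z)"
    using dist_orbit[OF p w z, of s i "Suc (Suc i)"] dist_signed_pow[OF w z s, of 2]
    by (simp add: x_def mult_2_right)
  show "10 * D + 1 \<le> dist (x i) (x (Suc i))"
    using tr unfolding 1 translates_def by simp
  show "gp (x (Suc i)) (x i) (x (Suc (Suc i))) \<le> 7 * D"
    using tr unfolding gp_def 1 2 dist_sym[of "x (Suc i)" "x i"] translates_def by simp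
qed

lemma orbit_growth:
  assumes "translates w j z" "w \<in> carrier G" "p \<in> carrier G" "\<bar>s\<bar> = int j"
  shows "\<bar>int a - int b\<bar> \<le> dist (orbit p w s z a) (orbit p w s z b)"
proof -
  have "int (b - a) \<le> dist (orbit p w s z a) (orbit p w s z b)" if "a \<le> b" for a b
    by (rule local_to_global_growth[where N = b and L = "10 * D + 1" and c = "7 * D"])
      (use that D_nonneg orbit_local[OF assms] in auto)
  from this[of a b] this[of b a] show ?thesis
    using dist_sym by (cases "a \<le> b") (auto simp: of_nat_diff)
qed

text \<open>Here \<open>9 * D\<close> is \<open>c + 2 * D\<close> for
  \<open>c = 7 * D\<close>.\<close>

lemma orbit_aligned:
  assumes "translates w j z" "w \<in> carrier G" "p \<in> carrier G" "\<bar>s\<bar> = int j" "a \<le> N"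
  shows "gp (orbit p w s z a) (orbit p w s z 0) (orbit p w s z N) \<le> 9 * D"
proof -
  have "gp (orbit p w s z a) (orbit p w s z 0) (orbit p w s z N) \<le> 7 * D + 2 * D"
    by (rule local_to_global_aligned[where L = "10 * D + 1"])
      (use assms(5) D_nonneg orbit_local[OF assms(1-4)] in auto)
  then show ?thesis
    by simp
qed

text \<open>Being close to the geodesic between the end points of an orbit is witnessed by an element of a
  finite set \<open>S\<close> that does not depend on where the orbit starts nor on its length.\<close>

lemma orbit_codes:
  assumes tr: "translates w j z" and w: "w \<in> carrier G" and s: "\<bar>s\<bar> = int j"
  shows "\<exists>S. finite S \<and>
      card S \<le> card (ball (nat (R + 31 * D + 1))) * ((order_bound + 2 * conj_bound) * (len w + 1) + 1) \<and>
      (\<forall>p\<in>carrier G. \<forall>u\<in>carrier G. \<forall>N>0. gp u (orbit p w s z 0) (orbit p w s z N) \<le> R \<longrightarrow>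
        (\<exists>b\<le>N. inv u \<otimes> orbit p w s z b \<in> S))"
proof -
  have z: "z \<in> carrier G"
    using tr by (rule translates_closed)
  define v where "v = inv z \<otimes> (w [^] s \<otimes> z)"
  have v: "v \<in> carrier G"
    using w z by (simp add: v_def)
  \<comment> \<open>All edges of all such orbits are left translates of the segment from the unit to
    \<open>v\<close>, so one choice of points along that segment serves every \<open>p\<close> and
    every edge.\<close>
  have "\<exists>q. q \<in> carrier G \<and> dist \<one> q = int t \<and> dist q v = int (len v) - int t" if "t \<le> len v" for t
    using dist_interp[of \<one> v "int t"] v that by (auto simp: dist_eq)
  then obtain \<gamma> where \<gamma>: "\<gamma> t \<in> carrier G" "dist \<one> (\<gamma> t) = int t" "dist (\<gamma> t) v = int (len v) - int t"
    if "t \<le> len v" for t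
    by metis
  let ?r = "nat (R + 31 * D + 1)"
  \<comment> \<open>\<open>h\<close> is the displacement from \<open>u\<close> to a point near it on
    a translated segment, and \<open>inv (\<gamma> t)\<close> leads back to the start of that edge.
    The radius collects \<open>27 * D + 2 * D\<close> from \<open>projection_to_chain\<close> and
    \<open>2 * D + 1\<close> from \<open>near_geodesic_point\<close>.\<close>
  define S where "S = (\<lambda>(h, t). h \<otimes> inv (\<gamma> t)) ` (ball ?r \<times> {0..len v})"
  have "finite S"
    unfolding S_def by (simp add: finite_ball)
  have "len v \<le> len z + (nat \<bar>s\<bar> * len w + len z)"
    using len_mult[of "inv z" "w [^] s \<otimes> z"] len_mult[of "w [^] s" z] len_int_pow[OF w, of s] w z
    by (simp add: v_def)
  also have "\<dots> \<le> conj_bound * (len w + 1) + (order_bound * (len w + 1) + conj_bound * (len w + 1))"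
    using tr s unfolding translates_def by (intro add_mono mult_le_mono) auto
  finally have "len v \<le> (order_bound + 2 * conj_bound) * (len w + 1)"
    by (simp add: algebra_simps)
  moreover have "card S \<le> card (ball ?r) * (len v + 1)"
    unfolding S_def using card_image_le[of "ball ?r \<times> {0..len v}" "\<lambda>(h, t). h \<otimes> inv (\<gamma> t)"]
    by (simp add: finite_ball card_cartesian_product)
  ultimately have "card S \<le> card (ball ?r) * ((order_bound + 2 * conj_bound) * (len w + 1) + 1)"
    by (meson add_le_mono1 le_trans mult_le_mono2)
  moreover have "\<exists>b\<le>N. inv u \<otimes> orbit p w s z b \<in> S"
    if p: "p \<in> carrier G" and u: "u \<in> carrier G" and N: "0 < N"
      and gp: "gp u (orbit p w s z 0) (orbit p w s z N) \<le> R" for p u and N :: nat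
  proof -
    let ?x = "orbit p w s z"
    obtain b where b: "b < N" "gp u (?x b) (?x (Suc b)) \<le> gp u (?x 0) (?x N) + 3 * (9 * D) + 2 * D"
      using projection_to_chain[OF N, of ?x "9 * D" u] orbit_aligned[OF tr w p s] by blast
    have x: "?x b \<in> carrier G" "?x (Suc b) \<in> carrier G"
      using p w z by auto
    have "inv (?x b) \<otimes> ?x (Suc b) = v"
      using inv_orbit_mult_orbit[OF p w z, of s b "Suc b"] by (simp add: v_def)
    then have xv: "?x (Suc b) = ?x b \<otimes> v"
      using x v by (metis inv_cancel_left(2))
    define T where "T = gp (?x b) u (?x (Suc b))"
    have T: "0 \<le> T" "T \<le> 2 * dist (?x b) (?x (Suc b))"
      using gp_nonneg[of "?x b" u "?x (Suc b)"] d_triangle[of "?x b" u "?x (Suc b)"]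
        d_commute[of u "?x (Suc b)"] unfolding T_def gp_def by linarith+
    have dv: "dist (?x b) (?x (Suc b)) = int (len v)"
      using x v by (simp add: xv dist_right_mult)
    define t where "t = nat (T div 2)"
    have t: "t \<le> len v" "2 * int t \<le> T" "T \<le> 2 * int t + 1"
      using T unfolding dv t_def by linarith+
    have q: "dist (?x b) (?x b \<otimes> \<gamma> t) = int t" "dist (?x b \<otimes> \<gamma> t) (?x (Suc b)) = int (len v) - int t"
      using \<gamma>[OF t(1)] dist_left_mult[of "?x b" \<one> "\<gamma> t"] x v unfolding xv by (simp_all add: dist_left_mult)
    have "2 * dist u (?x b \<otimes> \<gamma> t) \<le> gp u (?x b) (?x (Suc b)) + 1 + 2 * D"
      by (rule near_geodesic_point) (use q t dv T_def in auto)
    then have "dist u (?x b \<otimes> \<gamma> t) \<le> R + 31 * D + 1"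
      using b(2) gp d_nonneg[of u "?x b \<otimes> \<gamma> t"] by linarith
    then have "inv u \<otimes> (?x b \<otimes> \<gamma> t) \<in> ball ?r"
      using u x \<gamma>[OF t(1)] by (simp add: ball_def dist_eq le_nat_iff)
    moreover have "inv u \<otimes> ?x b = inv u \<otimes> (?x b \<otimes> \<gamma> t) \<otimes> inv (\<gamma> t)"
      using u x \<gamma>[OF t(1)] by (simp add: m_assoc)
    ultimately show ?thesis
      using b(1) t(1) unfolding S_def by (intro exI[of _ b]) force
  qed
  ultimately show ?thesis
    using \<open>finite S\<close> by (intro exI[of _ S]) blast
qed

end

section \<open>The algebra of products of powers\<close>

context group
begin

definition power_prod :: "(nat \<Rightarrow> 'a) \<Rightarrow> (nat \<Rightarrow> int) \<Rightarrow> nat \<Rightarrow> nat \<Rightarrow> 'a" where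
  "power_prod gs \<epsilon> s t = list_mult G (map (\<lambda>i. gs i [^] \<epsilon> i) [s..<t])"

lemma power_prod_closed [simp]:
  "(\<And>i. s \<le> i \<Longrightarrow> i < t \<Longrightarrow> gs i \<in> carrier G) \<Longrightarrow> power_prod gs \<epsilon> s t \<in> carrier G"
  unfolding power_prod_def by (intro list_mult_closed) auto

lemma power_prod_empty [simp]: "power_prod gs \<epsilon> s s = \<one>"
  by (simp add: power_prod_def)

lemma power_prod_split:
  assumes "\<And>i. s \<le> i \<Longrightarrow> i < u \<Longrightarrow> gs i \<in> carrier G" "s \<le> t" "t \<le> u"
  shows "power_prod gs \<epsilon> s u = power_prod gs \<epsilon> s t \<otimes> power_prod gs \<epsilon> t u"
proof -
  have "[s..<u] = [s..<t] @ [t..<u]"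
    using assms(2,3) by (metis le_Suc_ex upt_add_eq_append)
  then show ?thesis
    unfolding power_prod_def using assms by (simp only: map_append) (intro list_mult_append; auto)
qed

lemma power_prod_Suc [simp]: "gs i \<in> carrier G \<Longrightarrow> power_prod gs \<epsilon> i (Suc i) = gs i [^] \<epsilon> i"
  by (simp add: power_prod_def)

lemma power_prod_cong:
  "(\<And>i. s \<le> i \<Longrightarrow> i < t \<Longrightarrow> gs i [^] \<epsilon> i = gs i [^] \<epsilon>' i) \<Longrightarrow> power_prod gs \<epsilon> s t = power_prod gs \<epsilon>' s t"
  unfolding power_prod_def by (intro arg_cong[where f = "list_mult G"]) auto

lemma power_prod_split_at:
  assumes "\<And>i. i < k \<Longrightarrow> gs i \<in> carrier G" "i < l" "l < k"
  shows "power_prod gs \<epsilon> 0 l = power_prod gs \<epsilon> 0 i \<otimes> (gs i [^] \<epsilon> i \<otimes> power_prod gs \<epsilon> (Suc i) l)" (is ?A)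
    and "power_prod gs \<epsilon> 0 k = power_prod gs \<epsilon> 0 i \<otimes> (gs i [^] \<epsilon> i \<otimes> (power_prod gs \<epsilon> (Suc i) l \<otimes>
      gs l [^] \<epsilon> l) \<otimes> power_prod gs \<epsilon> (Suc l) k)" (is ?B)
proof -
  have c: "power_prod gs \<epsilon> s t \<in> carrier G" if "t \<le> k" for s t
    using assms(1) that by (intro power_prod_closed) auto
  have "power_prod gs \<epsilon> 0 l = power_prod gs \<epsilon> 0 i \<otimes> power_prod gs \<epsilon> i l"
    using assms by (intro power_prod_split) auto
  also have "power_prod gs \<epsilon> i l = power_prod gs \<epsilon> i (Suc i) \<otimes> power_prod gs \<epsilon> (Suc i) l"
    using assms by (intro power_prod_split) auto
  finally show ?A
    using assms by simp
  have "power_prod gs \<epsilon> 0 k = power_prod gs \<epsilon> 0 l \<otimes> power_prod gs \<epsilon> l k"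
    using assms by (intro power_prod_split) auto
  also have "power_prod gs \<epsilon> l k = power_prod gs \<epsilon> l (Suc l) \<otimes> power_prod gs \<epsilon> (Suc l) k"
    using assms by (intro power_prod_split) auto
  finally show ?B
    using \<open>?A\<close> assms c by (simp add: m_assoc)
qed

lemma l_cancel:
  assumes "x \<in> carrier G" "y \<in> carrier G" "z \<in> carrier G"
  shows "x \<otimes> y = x \<otimes> z \<longleftrightarrow> y = z"
  using assms inv_cancel_left(1)[of x] by metis

text \<open>Split off \<open>x [^] \<alpha>\<^sub>1\<close> on the left and
  \<open>y [^] (f - \<beta>\<^sub>1)\<close> on the right of the right-hand side; what remains in
  the middle is one side of \<open>eq\<close> and may be replaced by the other.\<close>

lemma exchange_powers:
  fixes e f \<alpha>\<^sub>1 \<alpha>\<^sub>2 \<beta>\<^sub>1 \<beta>\<^sub>2 :: int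
  assumes "x \<in> carrier G" "y \<in> carrier G" "m \<in> carrier G"
    and eq: "x [^] (e - \<alpha>\<^sub>1) \<otimes> (m \<otimes> y [^] \<beta>\<^sub>1) = x [^] (e - \<alpha>\<^sub>2) \<otimes> (m \<otimes> y [^] \<beta>\<^sub>2)"
  shows "x [^] (e + \<alpha>\<^sub>1 - \<alpha>\<^sub>2) \<otimes> (m \<otimes> y [^] (f + \<beta>\<^sub>2 - \<beta>\<^sub>1)) = x [^] e \<otimes> (m \<otimes> y [^] f)"
proof -
  have 1: "x [^] (e + \<alpha>\<^sub>1 - \<alpha>\<^sub>2) = x [^] \<alpha>\<^sub>1 \<otimes> x [^] (e - \<alpha>\<^sub>2)" "x [^] e = x [^] \<alpha>\<^sub>1 \<otimes> x [^] (e - \<alpha>\<^sub>1)"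
    using assms(1) by (simp_all add: int_pow_mult[symmetric] algebra_simps)
  have 2: "y [^] (f + \<beta>\<^sub>2 - \<beta>\<^sub>1) = y [^] \<beta>\<^sub>2 \<otimes> y [^] (f - \<beta>\<^sub>1)" "y [^] f = y [^] \<beta>\<^sub>1 \<otimes> y [^] (f - \<beta>\<^sub>1)"
    using assms(2) by (simp_all add: int_pow_mult[symmetric] algebra_simps)
  have "x [^] (e + \<alpha>\<^sub>1 - \<alpha>\<^sub>2) \<otimes> (m \<otimes> y [^] (f + \<beta>\<^sub>2 - \<beta>\<^sub>1)) =
      x [^] \<alpha>\<^sub>1 \<otimes> (x [^] (e - \<alpha>\<^sub>2) \<otimes> (m \<otimes> y [^] \<beta>\<^sub>2)) \<otimes> y [^] (f - \<beta>\<^sub>1)"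
    unfolding 1(1) 2(1) using assms(1-3) by (simp add: m_assoc)
  also have "\<dots> = x [^] e \<otimes> (m \<otimes> y [^] f)"
    unfolding eq[symmetric] 1(2) 2(2) using assms(1-3) by (simp add: m_assoc)
  finally show ?thesis .
qed

text \<open>The prefix before \<open>i\<close> cancels in a displacement, leaving the rest of the
  power at \<open>i\<close>, the factors strictly between, and the start of the power at
  \<open>l\<close>. Two equal displacements are therefore an instance of
  \<open>exchange_powers\<close>.\<close>

lemma exchange:
  fixes \<alpha>\<^sub>1 \<alpha>\<^sub>2 \<beta>\<^sub>1 \<beta>\<^sub>2 :: int
  assumes gs: "\<And>i. i < k \<Longrightarrow> gs i \<in> carrier G" and il: "i < l" "l < k"
    and z: "z \<in> carrier G" "z' \<in> carrier G"
    and eq: "inv (power_prod gs \<epsilon> 0 i \<otimes> (gs i [^] \<alpha>\<^sub>1 \<otimes> z)) \<otimes> (power_prod gs \<epsilon> 0 l \<otimes> (gs l [^] \<beta>\<^sub>1 \<otimes> z')) =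
      inv (power_prod gs \<epsilon> 0 i \<otimes> (gs i [^] \<alpha>\<^sub>2 \<otimes> z)) \<otimes> (power_prod gs \<epsilon> 0 l \<otimes> (gs l [^] \<beta>\<^sub>2 \<otimes> z'))"
  shows "power_prod gs (\<epsilon>(i := \<epsilon> i + \<alpha>\<^sub>1 - \<alpha>\<^sub>2, l := \<epsilon> l + \<beta>\<^sub>2 - \<beta>\<^sub>1)) 0 k = power_prod gs \<epsilon> 0 k"
proof -
  let ?\<epsilon> = "\<epsilon>(i := \<epsilon> i + \<alpha>\<^sub>1 - \<alpha>\<^sub>2, l := \<epsilon> l + \<beta>\<^sub>2 - \<beta>\<^sub>1)"
  let ?p = "power_prod gs \<epsilon> 0 i" and ?m = "power_prod gs \<epsilon> (Suc i) l" and ?s = "power_prod gs \<epsilon> (Suc l) k"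
  have c: "?p \<in> carrier G" "?m \<in> carrier G" "?s \<in> carrier G" "gs i \<in> carrier G" "gs l \<in> carrier G"
    using gs il by (auto intro!: power_prod_closed)
  have expand: "inv (?p \<otimes> (gs i [^] \<alpha> \<otimes> z)) \<otimes> (power_prod gs \<epsilon> 0 l \<otimes> (gs l [^] \<beta> \<otimes> z')) =
      inv z \<otimes> ((gs i [^] (\<epsilon> i - \<alpha>) \<otimes> (?m \<otimes> gs l [^] \<beta>)) \<otimes> z')" for \<alpha> \<beta> :: int
  proof -
    have 1: "gs i [^] \<epsilon> i = gs i [^] \<alpha> \<otimes> gs i [^] (\<epsilon> i - \<alpha>)"
      using c by (simp add: int_pow_mult[symmetric])
    have 2: "power_prod gs \<epsilon> 0 l = ?p \<otimes> (gs i [^] \<epsilon> i \<otimes> ?m)"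
      by (rule power_prod_split_at(1)[OF gs il])
    show ?thesis
      unfolding 2 1 using c z by (simp add: inv_mult_group m_assoc)
  qed
  have "gs i [^] (\<epsilon> i - \<alpha>\<^sub>1) \<otimes> (?m \<otimes> gs l [^] \<beta>\<^sub>1) \<otimes> z' = gs i [^] (\<epsilon> i - \<alpha>\<^sub>2) \<otimes> (?m \<otimes> gs l [^] \<beta>\<^sub>2) \<otimes> z'"
    using eq[unfolded expand] c z by (simp only: l_cancel inv_closed m_closed int_pow_closed)
  then have "gs i [^] (\<epsilon> i - \<alpha>\<^sub>1) \<otimes> (?m \<otimes> gs l [^] \<beta>\<^sub>1) = gs i [^] (\<epsilon> i - \<alpha>\<^sub>2) \<otimes> (?m \<otimes> gs l [^] \<beta>\<^sub>2)"
    using c z by (simp only: right_cancel m_closed int_pow_closed)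
  from exchange_powers[OF c(4,5,2) this, of "\<epsilon> l"]
  have swap: "gs i [^] ?\<epsilon> i \<otimes> (?m \<otimes> gs l [^] ?\<epsilon> l) = gs i [^] \<epsilon> i \<otimes> (?m \<otimes> gs l [^] \<epsilon> l)"
    using il by simp
  have same: "power_prod gs ?\<epsilon> 0 i = ?p" "power_prod gs ?\<epsilon> (Suc i) l = ?m" "power_prod gs ?\<epsilon> (Suc l) k = ?s"
    using il by (auto intro!: power_prod_cong)
  have split: "power_prod gs \<eta> 0 k = power_prod gs \<eta> 0 i \<otimes>
      (gs i [^] \<eta> i \<otimes> (power_prod gs \<eta> (Suc i) l \<otimes> gs l [^] \<eta> l) \<otimes> power_prod gs \<eta> (Suc l) k)" for \<eta>
    by (rule power_prod_split_at(2)[OF gs il])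
  show ?thesis
    unfolding split[of ?\<epsilon>] split[of \<epsilon>] same swap ..
qed

end

text \<open>Coordinates are fixed one at a time: among the elements that agree with the previous
  choice on the first \<open>k\<close> of them, take one with the least next value.\<close>

lemma lex_minimal_exists:
  fixes \<mu> :: "'b \<Rightarrow> nat \<Rightarrow> nat"
  assumes "A \<noteq> {}"
  shows "\<exists>f\<in>A. \<forall>h\<in>A. \<forall>m<k. (\<forall>i<m. \<mu> h i = \<mu> f i) \<longrightarrow> \<mu> f m \<le> \<mu> h m"
proof (induction k)
  case 0
  then show ?case
    using assms by auto
next
  case (Suc k)
  then obtain f where f: "f \<in> A" "\<And>h m. h \<in> A \<Longrightarrow> m < k \<Longrightarrow> \<forall>i<m. \<mu> h i = \<mu> f i \<Longrightarrow> \<mu> f m \<le> \<mu> h m"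
    by blast
  define g where "g = arg_min (\<lambda>h. \<mu> h k) (\<lambda>h. h \<in> A \<and> (\<forall>i<k. \<mu> h i = \<mu> f i))"
  have g: "g \<in> A" "\<forall>i<k. \<mu> g i = \<mu> f i"
    using arg_min_natI[of "\<lambda>h. h \<in> A \<and> (\<forall>i<k. \<mu> h i = \<mu> f i)" f "\<lambda>h. \<mu> h k"] f(1)
    by (auto simp: g_def)
  have min: "\<mu> g k \<le> \<mu> h k" if "h \<in> A" "\<forall>i<k. \<mu> h i = \<mu> f i" for h
    using arg_min_nat_le[of "\<lambda>h. h \<in> A \<and> (\<forall>i<k. \<mu> h i = \<mu> f i)" h "\<lambda>h. \<mu> h k"] that
    by (auto simp: g_def)
  have "\<mu> g m \<le> \<mu> h m" if "h \<in> A" "m < Suc k" "\<forall>i<m. \<mu> h i = \<mu> g i" for h m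
  proof (cases "m = k")
    case True
    then show ?thesis
      using min[OF that(1)] that(3) g(2) by simp
  next
    case False
    then have "m < k"
      using that(2) by simp
    then show ?thesis
      using f(2)[OF that(1), of m] that(3) g(2) by simp
  qed
  then show ?case
    using g(1) by blast
qed

section \<open>Lexicographically minimal products of powers\<close>

text \<open>A competitor that agrees in absolute value before \<open>m\<close> is compared at
  \<open>m\<close> only; its later exponents may be arbitrarily large.\<close>

locale minimal_power_prod = word_hyperbolic_group G Y D for G (structure) and Y D +
  fixes gs :: "nat \<Rightarrow> 'a" and k :: nat and \<epsilon> :: "nat \<Rightarrow> int"
  assumes gs_closed: "i < k \<Longrightarrow> gs i \<in> carrier G"
    and minimal: "power_prod gs \<epsilon>' 0 k = power_prod gs \<epsilon> 0 k \<Longrightarrow> m < k \<Longrightarrow>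
      \<forall>i<m. \<bar>\<epsilon>' i\<bar> = \<bar>\<epsilon> i\<bar> \<Longrightarrow> \<bar>\<epsilon> m\<bar> \<le> \<bar>\<epsilon>' m\<bar>"
begin

definition loxodromic :: "nat \<Rightarrow> bool" where
  "loxodromic i \<longleftrightarrow> (\<exists>j z. translates (gs i) j z)"

definition stride :: "nat \<Rightarrow> nat" where
  "stride i = fst (SOME jz. translates (gs i) (fst jz) (snd jz))"

definition conjugator :: "nat \<Rightarrow> 'a" where
  "conjugator i = (if loxodromic i then snd (SOME jz. translates (gs i) (fst jz) (snd jz)) else \<one>)"

text \<open>With the defaults, 0 here and the unit for \<open>conjugator\<close>, a side that is not
  loxodromic shrinks to its first vertex, and its whole power becomes the remainder covered by
  \<open>remainder_bound\<close>.\<close>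

definition steps :: "nat \<Rightarrow> nat" where
  "steps i = (if loxodromic i then nat \<bar>\<epsilon> i\<bar> div stride i else 0)"

definition signed_stride :: "nat \<Rightarrow> int" where
  "signed_stride i = (if \<epsilon> i < 0 then - int (stride i) else int (stride i))"

definition vertex :: "nat \<Rightarrow> 'a" where
  "vertex i = power_prod gs \<epsilon> 0 i"

definition side :: "nat \<Rightarrow> nat \<Rightarrow> 'a" where
  "side i = orbit (vertex i) (gs i) (signed_stride i) (conjugator i)"

lemma translates_side: "loxodromic i \<Longrightarrow> translates (gs i) (stride i) (conjugator i)"
  unfolding loxodromic_def stride_def conjugator_def
  using someI_ex[of "\<lambda>jz. translates (gs i) (fst jz) (snd jz)"] by auto

lemma abs_signed_stride: "\<bar>signed_stride i\<bar> = int (stride i)"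
  by (simp add: signed_stride_def)

lemma stride_bounds: "loxodromic i \<Longrightarrow> 1 \<le> stride i" "loxodromic i \<Longrightarrow> stride i \<le> order_bound"
  using translates_side by (auto simp: translates_def)

lemma conjugator_closed [simp]: "conjugator i \<in> carrier G"
  using translates_side[of i] by (cases "loxodromic i") (auto simp: translates_def conjugator_def)

lemma len_conjugator: "len (conjugator i) \<le> conj_bound * (len (gs i) + 1)"
  using translates_side[of i] by (cases "loxodromic i") (auto simp: translates_def conjugator_def)

lemma vertex_closed [simp]: "i \<le> k \<Longrightarrow> vertex i \<in> carrier G"
  using gs_closed by (auto simp: vertex_def intro!: power_prod_closed)

lemma side_closed [simp]: "i < k \<Longrightarrow> side i a \<in> carrier G"
  using gs_closed by (simp add: side_def)

lemma vertex_Suc: "i < k \<Longrightarrow> vertex (Suc i) = vertex i \<otimes> gs i [^] \<epsilon> i"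
  using gs_closed unfolding vertex_def by (subst power_prod_split[of 0 "Suc i" gs i]) auto

text \<open>A factor without a translating power has order at most \<open>order_bound\<close>.
  Shifting a larger exponent towards 0 by a multiple of the order would keep the product and
  contradict minimality.\<close>

lemma small_if_not_loxodromic:
  assumes "i < k" "\<not> loxodromic i"
  shows "\<bar>\<epsilon> i\<bar> \<le> int order_bound"
proof (rule ccontr)
  assume large: "\<not> ?thesis"
  obtain j :: nat where j: "1 \<le> j" "j \<le> order_bound" "gs i [^] j = \<one>"
    using torsion_or_translates[OF gs_closed[OF assms(1)]] assms(2) by (auto simp: loxodromic_def)
  define c where "c = (if \<epsilon> i < 0 then int j else - int j)"
  have "gs i [^] int j = \<one>" "gs i [^] (- int j) = \<one>"
    using j(3) gs_closed[OF assms(1)] by (simp_all add: int_pow_int int_pow_neg)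
  then have "gs i [^] c = \<one>"
    by (simp add: c_def)
  then have "gs i [^] (\<epsilon> i + c) = gs i [^] \<epsilon> i"
    using gs_closed[OF assms(1)] by (simp add: int_pow_mult)
  then have "power_prod gs (\<epsilon>(i := \<epsilon> i + c)) 0 k = power_prod gs \<epsilon> 0 k"
    by (intro power_prod_cong) auto
  from minimal[OF this assms(1)] have "\<bar>\<epsilon> i\<bar> \<le> \<bar>\<epsilon> i + c\<bar>"
    by simp
  then show False
    using large j(1,2) unfolding c_def by (auto split: if_splits)
qed

lemma remainder_bound:
  assumes "i < k"
  shows "\<bar>\<epsilon> i - signed_stride i * int (steps i)\<bar> \<le> int order_bound"
proof (cases "loxodromic i")
  case True
  have "nat \<bar>\<epsilon> i\<bar> = stride i * steps i + nat \<bar>\<epsilon> i\<bar> mod stride i"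
    using True by (simp add: steps_def)
  moreover have "nat \<bar>\<epsilon> i\<bar> mod stride i \<le> order_bound"
    using stride_bounds[OF True] mod_less_divisor[of "stride i" "nat \<bar>\<epsilon> i\<bar>"] by linarith
  ultimately have "int (stride i * steps i) \<le> \<bar>\<epsilon> i\<bar>" "\<bar>\<epsilon> i\<bar> \<le> int (stride i * steps i) + int order_bound"
    by linarith+
  then show ?thesis
    by (auto simp: signed_stride_def)
next
  case False
  then show ?thesis
    using small_if_not_loxodromic[OF assms] by (simp add: steps_def)
qed

text \<open>\<open>signed_stride\<close> has the sign of the exponent, so removing the piece from
  \<open>a\<close> to \<open>a'\<close> moves the exponent towards 0; as \<open>a'\<close> is at
  most \<open>steps i\<close>, it cannot overshoot.\<close>

lemma abs_shift_less:
  assumes "loxodromic i" "a < a'" "a' \<le> steps i"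
  shows "\<bar>\<epsilon> i + signed_stride i * int a - signed_stride i * int a'\<bar> < \<bar>\<epsilon> i\<bar>"
proof -
  define t where "t = int (stride i * (a' - a))"
  have "stride i * (a' - a) \<le> stride i * steps i"
    using assms by (intro mult_le_mono2) auto
  also have "\<dots> \<le> nat \<bar>\<epsilon> i\<bar>"
    using assms(1) by (simp add: steps_def)
  finally have "t \<le> \<bar>\<epsilon> i\<bar>"
    unfolding t_def by linarith
  moreover have "0 < t"
    using assms stride_bounds(1)[OF assms(1)] by (simp add: t_def)
  moreover have "signed_stride i * int a - signed_stride i * int a' = (if \<epsilon> i < 0 then t else - t)"
    using assms(2) by (simp add: t_def signed_stride_def of_nat_diff algebra_simps)
  ultimately show ?thesis
    by (smt (verit))
qed

lemma exchange_sides: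
  assumes "i < l" "l < k"
    and "inv (side i a) \<otimes> side l b = inv (side i a') \<otimes> side l b'"
  shows "power_prod gs (\<epsilon>(i := \<epsilon> i + signed_stride i * int a - signed_stride i * int a',
      l := \<epsilon> l + signed_stride l * int b' - signed_stride l * int b)) 0 k = power_prod gs \<epsilon> 0 k"
  by (rule exchange[OF gs_closed assms(1,2) conjugator_closed conjugator_closed])
    (use assms(3) in \<open>simp_all add: side_def orbit_def vertex_def\<close>)

text \<open>Of the two exchanges that a coincidence allows, one decreases the exponent of the earlier side.
  Whether the two sides run in the same direction or in opposite directions does not matter, since
  minimality is lexicographic.\<close>

lemma no_coincidence:
  assumes "i < k" "l < k" "i \<noteq> l" "loxodromic i" "loxodromic l"
    and "a \<noteq> a'" "a \<le> steps i" "a' \<le> steps i" "b \<le> steps l" "b' \<le> steps l"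
    and "inv (side i a) \<otimes> side l b = inv (side i a') \<otimes> side l b'"
  shows False
proof -
  have main: False if "i < l" "l < k" "loxodromic i" "a < a'" "a' \<le> steps i"
    "inv (side i a) \<otimes> side l b = inv (side i a') \<otimes> side l b'" for i l a a' b b'
  proof -
    have "\<bar>\<epsilon> i\<bar> \<le> \<bar>(\<epsilon>(i := \<epsilon> i + signed_stride i * int a - signed_stride i * int a',
        l := \<epsilon> l + signed_stride l * int b' - signed_stride l * int b)) i\<bar>"
      using that by (intro minimal exchange_sides) auto
    then show False
      using abs_shift_less[OF that(3-5)] that(1) by simp
  qed
  \<comment> \<open>Here the earlier side \<open>l\<close> contributes the same point twice. The
    exchange leaves its exponent unchanged, so a decrease on the later side \<open>i\<close> already
    contradicts minimality.\<close>
  have same: False if "l < i" "i < k" "loxodromic i" "a < a'" "a' \<le> steps i"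
    "inv (side l b) \<otimes> side i a = inv (side l b) \<otimes> side i a'" for i l a a' b
  proof -
    have "\<bar>\<epsilon> i\<bar> \<le> \<bar>(\<epsilon>(l := \<epsilon> l + signed_stride l * int b - signed_stride l * int b,
        i := \<epsilon> i + signed_stride i * int a - signed_stride i * int a')) i\<bar>"
      using that by (intro minimal exchange_sides) auto
    then show False
      using abs_shift_less[OF that(3-5)] by simp
  qed
  show False
  proof (cases "i < l")
    case True
    then show False
      using main[of i l a a' b b'] main[of i l a' a b' b] assms by (metis linorder_neqE_nat)
  next
    case False
    then have "l < i"
      using assms(3) by simp
    have "inv (inv (side i a) \<otimes> side l b) = inv (inv (side i a') \<otimes> side l b')"
      using assms(11) by simp
    then have eq: "inv (side l b) \<otimes> side i a = inv (side l b') \<otimes> side i a'"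
      using assms(1,2) by (simp add: inv_mult_group)
    show False
    proof (cases "b = b'")
      case True
      then show False
        using same[OF \<open>l < i\<close> assms(1,4), of a a' b] same[OF \<open>l < i\<close> assms(1,4), of a' a b] eq assms(6-8)
        by (metis linorder_neqE_nat)
    next
      case False
      then show False
        using main[OF \<open>l < i\<close> assms(1,5), of b b' a a'] main[OF \<open>l < i\<close> assms(1,5), of b' b a' a] eq assms(9,10)
        by (metis linorder_neqE_nat)
    qed
  qed
qed

text \<open>Each factor contributes three corners. The edges starting at indices congruent to 1
  modulo 3 are the long sides; the other two kinds are short connections, out to the conjugated
  orbit and back to the next vertex.\<close>

definition corner :: "nat \<Rightarrow> 'a" where
  "corner e = (if e mod 3 = 0 then vertex (e div 3) else if e mod 3 = 1 then side (e div 3) 0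
     else side (e div 3) (steps (e div 3)))"

lemma corner_simps [simp]:
  "corner (3 * i) = vertex i" "corner (Suc (3 * i)) = side i 0"
  "corner (Suc (Suc (3 * i))) = side i (steps i)" "corner (Suc (Suc (Suc (3 * i)))) = vertex (Suc i)"
proof -
  have "Suc (3 * i) div 3 = i" "Suc (3 * i) mod 3 = 1" "Suc (Suc (3 * i)) div 3 = i"
    "Suc (Suc (3 * i)) mod 3 = 2" "Suc (Suc (Suc (3 * i))) = 3 * Suc i"
    by presburger+
  then show "corner (3 * i) = vertex i" "corner (Suc (3 * i)) = side i 0"
    "corner (Suc (Suc (3 * i))) = side i (steps i)" "corner (Suc (Suc (Suc (3 * i)))) = vertex (Suc i)"
    unfolding corner_def by simp_all
qed

text \<open>Covers the conjugator, the remaining power left by the division by the stride and,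
  through the summand 1, the closing edge, whose length is that of the whole product.\<close>

definition edge_bound :: "nat \<Rightarrow> nat" where
  "edge_bound n = (conj_bound + order_bound + 1) * (n + 1)"

lemma dist_vertex_side:
  assumes "i < k" "len (gs i) \<le> n"
  shows "dist (vertex i) (side i 0) \<le> int (edge_bound n)"
    and "dist (side i (steps i)) (vertex (Suc i)) \<le> int (edge_bound n)"
proof -
  have g: "gs i \<in> carrier G"
    using gs_closed[OF assms(1)] .
  have v: "vertex i \<in> carrier G"
    using assms(1) by simp
  have z: "len (conjugator i) \<le> conj_bound * (n + 1)"
    using len_conjugator[of i] assms(2) by (meson add_le_mono1 le_trans mult_le_mono2)
  have eb: "len (conjugator i) + order_bound * n \<le> edge_bound n"
    using z unfolding edge_bound_def by (simp add: algebra_simps)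
  have "dist (vertex i) (side i 0) = int (len (conjugator i))"
    using g v by (simp add: side_def orbit_def dist_right_mult)
  then show "dist (vertex i) (side i 0) \<le> int (edge_bound n)"
    using eb by linarith
  let ?r = "\<epsilon> i - signed_stride i * int (steps i)"
  have "gs i [^] \<epsilon> i = gs i [^] (signed_stride i * int (steps i)) \<otimes> gs i [^] ?r"
    using g by (simp add: int_pow_mult[symmetric])
  then have "dist (side i (steps i)) (vertex (Suc i)) = dist (conjugator i) (gs i [^] ?r)"
    using g v unfolding vertex_Suc[OF assms(1)] side_def orbit_def by (simp add: dist_left_mult)
  also have "\<dots> \<le> dist \<one> (conjugator i) + dist \<one> (gs i [^] ?r)"
    using d_triangle[of "conjugator i" "gs i [^] ?r" \<one>] dist_sym[of \<one> "conjugator i"] by simp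
  also have "\<dots> = int (len (conjugator i) + len (gs i [^] ?r))"
    using g by (simp add: dist_eq)
  also have "len (gs i [^] ?r) \<le> order_bound * n"
    using len_int_pow[OF g, of ?r] remainder_bound[OF assms(1)] assms(2)
    by (meson le_trans mult_le_mono nat_le_iff)
  finally show "dist (side i (steps i)) (vertex (Suc i)) \<le> int (edge_bound n)"
    using eb by linarith
qed

text \<open>If every other edge were far, chaining on both sides and across the closing edge would
  give the end points of side \<open>i\<close> a large product at its own point. Alignment bounds
  that product by \<open>9 * D\<close>. The 11 is this 9 plus two final uses of
  \<open>gp_min\<close>; \<open>N\<close> pays for the chains.\<close>

lemma close_to_other_edge:
  assumes i: "i < k" "loxodromic i" "a \<le> steps i" and N: "3 * k \<le> 2 ^ N"
  shows "gp (side i a) (corner (3 * k)) (corner 0) \<le> (int N + 11) * D \<or>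
    (\<exists>e<3 * k. e \<noteq> Suc (3 * i) \<and> gp (side i a) (corner e) (corner (Suc e)) \<le> (int N + 11) * D)"
proof (rule ccontr)
  assume neg: "\<not> ?thesis"
  let ?u = "side i a" and ?R = "(int N + 11) * D"
  have R: "?R = int N * D + 11 * D" "0 \<le> int N * D"
    using D_nonneg by (simp_all add: algebra_simps)
  have far: "?R < gp ?u (corner e) (corner (Suc e))" if "e < 3 * k" "e \<noteq> Suc (3 * i)" for e
    using neg that by (meson not_le)
  have "?R - int N * D < gp ?u (corner 0) (corner (Suc (3 * i)))"
    by (intro gp_chain far) (use i(1) N in auto)
  moreover have "?R - int N * D < gp ?u (corner (Suc (Suc (3 * i)))) (corner (3 * k))"
    by (intro gp_chain far) (use i(1) N in auto)
  moreover have "?R < gp ?u (corner (3 * k)) (corner 0)"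
    using neg by auto
  moreover have "gp ?u (corner (Suc (3 * i))) (corner (Suc (Suc (3 * i)))) \<le> 9 * D"
    using orbit_aligned[OF translates_side[OF i(2)] gs_closed[OF i(1)] vertex_closed abs_signed_stride i(3)] i(1)
    by (simp add: side_def)
  ultimately show False
    using gp_min[of ?u "corner (Suc (3 * i))" "corner 0" "corner (Suc (Suc (3 * i)))"]
      gp_min[of ?u "corner 0" "corner (3 * k)" "corner (Suc (Suc (3 * i)))"] R D_nonneg
      gp_commute[of ?u "corner 0" "corner (Suc (3 * i))"] gp_commute[of ?u "corner 0" "corner (3 * k)"]
      gp_commute[of ?u "corner (3 * k)" "corner (Suc (Suc (3 * i)))"]
    by linarith
qed

text \<open>A small product with a short edge puts the point near the start of that edge. An edge
  that is not short must be a long side with at least one step, which also makes it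
  loxodromic.\<close>

lemma near_corner_or_side:
  assumes i: "i < k" "loxodromic i" "a \<le> steps i" and N: "3 * k \<le> 2 ^ N"
    and n: "\<And>l. l < k \<Longrightarrow> len (gs l) \<le> n" "len (vertex k) \<le> n"
  shows "(\<exists>e\<le>3 * k. dist (side i a) (corner e) \<le> (int N + 11) * D + int (edge_bound n)) \<or>
    (\<exists>l<k. l \<noteq> i \<and> loxodromic l \<and> 0 < steps l \<and>
      gp (side i a) (side l 0) (side l (steps l)) \<le> (int N + 11) * D)"
proof -
  let ?u = "side i a" and ?R = "(int N + 11) * D"
  have short: "dist ?u x \<le> ?R + int (edge_bound n)"
    if "gp ?u x y \<le> ?R" "dist x y \<le> int (edge_bound n)" for x y
    using that d_triangle[of ?u x y] dist_sym[of x y] gp_nonneg[of ?u x y] unfolding gp_def by linarith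
  from close_to_other_edge[OF i N] show ?thesis
  proof
    assume gp: "gp ?u (corner (3 * k)) (corner 0) \<le> ?R"
    have "corner (3 * 0) = \<one>"
      unfolding corner_simps by (simp add: vertex_def)
    then have "dist (corner (3 * k)) (corner 0) = int (len (vertex k))"
      by (simp add: dist_eq)
    also have "\<dots> \<le> int (edge_bound n)"
    proof -
      have "n \<le> edge_bound n"
        by (simp add: edge_bound_def)
      then show ?thesis
        using n(2) by linarith
    qed
    finally show ?thesis
      using short[OF gp] by blast
  next
    assume "\<exists>e<3 * k. e \<noteq> Suc (3 * i) \<and> gp ?u (corner e) (corner (Suc e)) \<le> ?R"
    then obtain e where e: "e < 3 * k" "e \<noteq> Suc (3 * i)" "gp ?u (corner e) (corner (Suc e)) \<le> ?R"
      by blast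
    define l where "l = e div 3"
    have l: "l < k" and cases: "e = 3 * l \<or> e = Suc (3 * l) \<or> e = Suc (Suc (3 * l))"
      using e(1) unfolding l_def by presburger+
    show ?thesis
    proof (cases "dist (corner e) (corner (Suc e)) \<le> int (edge_bound n)")
      case True
      then show ?thesis
        using short[OF e(3)] e(1) by (meson less_imp_le_nat)
    next
      case False
      then have "e = Suc (3 * l)"
        using cases dist_vertex_side[OF l n(1)[OF l]] by auto
      moreover from this have "steps l \<noteq> 0"
        using False by (intro notI) (simp add: edge_bound_def)
      ultimately show ?thesis
        using e(2,3) l by (auto simp: steps_def split: if_splits)
    qed
  qed
qed

text \<open>Orbit points separate at least as fast as their indices, so the indices in question lie
  in a window of width \<open>2 * r\<close>.\<close>

lemma card_near_point:
  assumes "i < k" "loxodromic i"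
  shows "card {a. a \<le> steps i \<and> dist (side i a) x \<le> int r} \<le> 2 * r + 1"
proof (cases "{a. a \<le> steps i \<and> dist (side i a) x \<le> int r} = {}")
  case False
  let ?A = "{a. a \<le> steps i \<and> dist (side i a) x \<le> int r}"
  define m where "m = Min ?A"
  have fin: "finite ?A"
    by (rule finite_subset[of _ "{..steps i}"]) auto
  have m: "m \<in> ?A"
    unfolding m_def by (rule Min_in[OF fin False])
  have m_le: "m \<le> a" if "a \<in> ?A" for a
    unfolding m_def by (rule Min_le[OF fin that])
  have "a \<le> m + 2 * r" if "a \<in> ?A" for a
  proof -
    have "\<bar>int a - int m\<bar> \<le> dist (side i a) (side i m)"
      unfolding side_def
      by (rule orbit_growth[OF translates_side[OF assms(2)] gs_closed[OF assms(1)] _ abs_signed_stride])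
        (use assms(1) in simp)
    also have "\<dots> \<le> dist (side i a) x + dist (side i m) x"
      using d_triangle[of "side i a" "side i m" x] dist_sym[of x "side i m"] by simp
    moreover have "dist (side i a) x \<le> int r" "dist (side i m) x \<le> int r"
      using that m by auto
    ultimately show ?thesis
      by linarith
  qed
  then have "?A \<subseteq> {m..m + 2 * r}"
    using m_le by auto
  then have "card ?A \<le> card {m..m + 2 * r}"
    by (intro card_mono) auto
  then show ?thesis
    by simp
next
  case True
  show ?thesis
    unfolding True by simp
qed

text \<open>The bound of \<open>orbit_codes\<close> for \<open>R = (int N + 11) * D\<close>, whence
  42 = 11 + 31.\<close>

definition side_bound :: "nat \<Rightarrow> nat \<Rightarrow> nat" where
  "side_bound N n = card (ball (nat ((int N + 42) * D + 1))) *
     ((order_bound + 2 * conj_bound) * (n + 1) + 1)"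

text \<open>Send \<open>a\<close> to the displacement from \<open>side i a\<close> to a point of
  side \<open>l\<close> that has its code in \<open>S\<close>. By \<open>no_coincidence\<close> this
  map is injective.\<close>

lemma card_near_side:
  assumes i: "i < k" "loxodromic i" and l: "l < k" "len (gs l) \<le> n"
  shows "card {a. a \<le> steps i \<and> l \<noteq> i \<and> loxodromic l \<and> 0 < steps l \<and>
      gp (side i a) (side l 0) (side l (steps l)) \<le> (int N + 11) * D} \<le> side_bound N n" (is "card ?A \<le> _")
proof (cases "l \<noteq> i \<and> loxodromic l \<and> 0 < steps l")
  case True
  let ?R = "(int N + 11) * D"
  have R: "?R + 31 * D + 1 = (int N + 42) * D + 1"
    by (simp add: algebra_simps)
  obtain S where S: "finite S"
    "card S \<le> card (ball (nat (?R + 31 * D + 1))) * ((order_bound + 2 * conj_bound) * (len (gs l) + 1) + 1)"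
    "\<And>p u M. p \<in> carrier G \<Longrightarrow> u \<in> carrier G \<Longrightarrow> 0 < M \<Longrightarrow>
      gp u (orbit p (gs l) (signed_stride l) (conjugator l) 0)
        (orbit p (gs l) (signed_stride l) (conjugator l) M) \<le> ?R \<Longrightarrow>
      \<exists>b\<le>M. inv u \<otimes> orbit p (gs l) (signed_stride l) (conjugator l) b \<in> S"
    using orbit_codes[OF translates_side gs_closed[OF l(1)] abs_signed_stride, of ?R] True by blast
  have "card S \<le> side_bound N n"
    using S(2) l(2) unfolding R side_bound_def
    by (meson add_le_mono1 le_trans mult_le_mono2)
  have "\<exists>b\<le>steps l. inv (side i a) \<otimes> side l b \<in> S" if "a \<in> ?A" for a
    using S(3)[of "vertex l" "side i a" "steps l"] that i(1) l(1) by (simp add: side_def[of l])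
  then have "\<forall>a\<in>?A. \<exists>b. b \<le> steps l \<and> inv (side i a) \<otimes> side l b \<in> S"
    by blast
  then obtain b where b: "\<forall>a\<in>?A. b a \<le> steps l \<and> inv (side i a) \<otimes> side l (b a) \<in> S"
    by (rule bchoice[THEN exE])
  have "inj_on (\<lambda>a. inv (side i a) \<otimes> side l (b a)) ?A"
  proof (rule inj_onI, rule ccontr)
    fix a a' assume a: "a \<in> ?A" "a' \<in> ?A" "a \<noteq> a'"
      and eq: "inv (side i a) \<otimes> side l (b a) = inv (side i a') \<otimes> side l (b a')"
    show False
      by (rule no_coincidence[OF i(1) l(1) _ i(2) _ a(3) _ _ _ _ eq]) (use True a b in auto)
  qed
  then have "card ?A \<le> card S"
    by (rule card_inj_on_le) (use b S(1) in auto)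
  then show ?thesis
    using \<open>card S \<le> side_bound N n\<close> by simp
next
  case False
  then have "?A = {}"
    by blast
  then show ?thesis
    by (metis card.empty le0)
qed

text \<open>The \<open>steps i + 1\<close> orbit points are covered by \<open>3 * k + 1\<close> sets
  of points near a corner and \<open>k\<close> sets of points near another side.\<close>

lemma steps_bound:
  assumes i: "i < k" "loxodromic i" and N: "3 * k \<le> 2 ^ N"
    and n: "\<And>l. l < k \<Longrightarrow> len (gs l) \<le> n" "len (vertex k) \<le> n"
  shows "steps i + 1 \<le> (3 * k + 1) * (2 * (nat ((int N + 11) * D) + edge_bound n) + 1) + k * side_bound N n"
proof -
  let ?r = "nat ((int N + 11) * D) + edge_bound n"
  let ?A = "\<lambda>e. {a. a \<le> steps i \<and> dist (side i a) (corner e) \<le> int ?r}"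
  let ?B = "\<lambda>l. {a. a \<le> steps i \<and> l \<noteq> i \<and> loxodromic l \<and> 0 < steps l \<and>
      gp (side i a) (side l 0) (side l (steps l)) \<le> (int N + 11) * D}"
  have r: "int ?r = (int N + 11) * D + int (edge_bound n)"
    using D_nonneg by simp
  have "{..steps i} \<subseteq> (\<Union>e\<in>{..3 * k}. ?A e) \<union> (\<Union>l\<in>{..<k}. ?B l)"
  proof
    fix a assume "a \<in> {..steps i}"
    then have "a \<le> steps i"
      by simp
    from near_corner_or_side[OF i this N n] this show "a \<in> (\<Union>e\<in>{..3 * k}. ?A e) \<union> (\<Union>l\<in>{..<k}. ?B l)"
      unfolding r by blast
  qed
  then have "card {..steps i} \<le> card ((\<Union>e\<in>{..3 * k}. ?A e) \<union> (\<Union>l\<in>{..<k}. ?B l))"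
    by (rule card_mono[rotated]) simp
  also have "\<dots> \<le> card (\<Union>e\<in>{..3 * k}. ?A e) + card (\<Union>l\<in>{..<k}. ?B l)"
    by (rule card_Un_le)
  also have "card (\<Union>e\<in>{..3 * k}. ?A e) \<le> (\<Sum>e\<in>{..3 * k}. card (?A e))"
    by (rule card_UN_le) simp
  also have "\<dots> \<le> (\<Sum>e\<in>{..3 * k}. 2 * ?r + 1)"
    by (rule sum_mono) (rule card_near_point[OF i])
  also have "card (\<Union>l\<in>{..<k}. ?B l) \<le> (\<Sum>l\<in>{..<k}. card (?B l))"
    by (rule card_UN_le) simp
  also have "\<dots> \<le> (\<Sum>l\<in>{..<k}. side_bound N n)"
    by (rule sum_mono) (rule card_near_side[OF i], use n in auto)
  finally show ?thesis
    by simp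
qed

lemma exponent_bound:
  assumes i: "i < k" and N: "3 * k \<le> 2 ^ N"
    and n: "\<And>l. l < k \<Longrightarrow> len (gs l) \<le> n" "len (vertex k) \<le> n"
  shows "nat \<bar>\<epsilon> i\<bar> \<le> order_bound *
    ((3 * k + 1) * (2 * (nat ((int N + 11) * D) + edge_bound n) + 1) + k * side_bound N n)" (is "_ \<le> _ * ?M")
proof (cases "loxodromic i")
  case True
  have "nat \<bar>\<epsilon> i\<bar> = stride i * steps i + nat \<bar>\<epsilon> i\<bar> mod stride i"
    using True by (simp add: steps_def)
  also have "\<dots> \<le> stride i * steps i + stride i"
    using stride_bounds(1)[OF True] by (simp add: less_imp_le_nat)
  also have "\<dots> = stride i * (steps i + 1)"
    by simp
  also have "\<dots> \<le> order_bound * ?M"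
    using stride_bounds(2)[OF True] steps_bound[OF i True N n] by (intro mult_le_mono)
  finally show ?thesis .
next
  case False
  have "nat \<bar>\<epsilon> i\<bar> \<le> order_bound * 1"
    using small_if_not_loxodromic[OF i False] by simp
  also have "\<dots> \<le> order_bound * ?M"
    by (intro mult_le_mono2) simp
  finally show ?thesis .
qed

end

section \<open>Polynomial bounds\<close>

text \<open>Supplies an integer logarithm: \<open>N\<close> bounds the depth of bisection, while
  \<open>2 ^ N\<close> stays linear.\<close>

lemma exists_power_of_two: "\<exists>N. m \<le> 2 ^ N \<and> 2 ^ N \<le> 2 * m + (1 :: nat)"
proof (induction m)
  case 0
  then show ?case
    by (intro exI[of _ 0]) simp
next
  case (Suc m)
  then obtain N where N: "m \<le> 2 ^ N" "2 ^ N \<le> 2 * m + (1 :: nat)"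
    by blast
  show ?case
  proof (cases "Suc m \<le> 2 ^ N")
    case True
    then show ?thesis
      using N(2) by (intro exI[of _ N]) simp
  next
    case False
    then have "2 ^ N = m"
      using N(1) by simp
    moreover have "0 < (2 :: nat) ^ N"
      by simp
    ultimately show ?thesis
      by (intro exI[of _ "Suc N"]) simp
  qed
qed

context word_hyperbolic_group
begin

text \<open>From \<open>W \<le> 2 ^ W\<close> follows \<open>W ^ N \<le> (2 ^ N) ^ W\<close>, which
  is at most \<open>(6 * s) ^ W\<close>: an exponential in a logarithm becomes a power of
  \<open>s\<close>.\<close>

lemma card_ball_polynomial:
  assumes "2 ^ N \<le> 6 * s"
  defines "W \<equiv> card (insert \<one> (letters G Y))" and "\<delta> \<equiv> nat D"
  shows "card (ball (nat ((int N + 42) * D + 1))) \<le> W ^ (42 * \<delta> + 1) * 6 ^ (W * \<delta>) * s ^ (W * \<delta>)"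
proof -
  have D: "D = int \<delta>"
    using D_nonneg by (simp add: \<delta>_def)
  have "(int N + 42) * D + 1 = int (N * \<delta> + (42 * \<delta> + 1))"
    unfolding D by (simp add: algebra_simps)
  then have r: "nat ((int N + 42) * D + 1) = N * \<delta> + (42 * \<delta> + 1)"
    by (metis nat_int)
  have "W ^ N \<le> (2 ^ W) ^ N"
    by (intro power_mono) (auto simp: less_exp less_imp_le_nat)
  also have "\<dots> = (2 ^ N) ^ W"
    by (simp add: power_mult[symmetric] mult.commute)
  also have "\<dots> \<le> (6 * s) ^ W"
    by (intro power_mono assms(1)) simp
  finally have "(W ^ N) ^ \<delta> \<le> ((6 * s) ^ W) ^ \<delta>"
    by (intro power_mono) simp_all
  then have "W ^ (N * \<delta>) \<le> 6 ^ (W * \<delta>) * s ^ (W * \<delta>)"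
    by (simp add: power_mult power_mult_distrib)
  then have "W ^ (42 * \<delta> + 1) * W ^ (N * \<delta>) \<le> W ^ (42 * \<delta> + 1) * (6 ^ (W * \<delta>) * s ^ (W * \<delta>))"
    by (rule mult_le_mono2)
  moreover have "card (ball (nat ((int N + 42) * D + 1))) \<le> W ^ (42 * \<delta> + 1) * W ^ (N * \<delta>)"
    using card_ball[of "N * \<delta> + (42 * \<delta> + 1)"] unfolding r W_def by (simp only: power_add mult.commute)
  ultimately show ?thesis
    by (simp only: mult.assoc)
qed

lemma polynomial_exponents:
  "\<exists>c e :: nat. \<forall>k gs \<epsilon> n. (\<forall>i<k. gs i \<in> carrier G \<and> len (gs i) \<le> n) \<and> len (power_prod gs \<epsilon> 0 k) \<le> n \<longrightarrow>
    (\<exists>\<epsilon>'. power_prod gs \<epsilon>' 0 k = power_prod gs \<epsilon> 0 k \<and> (\<forall>i<k. nat \<bar>\<epsilon>' i\<bar> \<le> c * (k + n + 1) ^ e))"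
proof -
  define \<delta> where "\<delta> = nat D"
  define W where "W = card (insert \<one> (letters G Y))"
  define c1 where "c1 = conj_bound + order_bound + 1"
  define c2 where "c2 = order_bound + 2 * conj_bound + 1"
  define c3 where "c3 = W ^ (42 * \<delta> + 1) * 6 ^ (W * \<delta>)"
  define c where "c = order_bound * (3 * (2 * (17 * \<delta> + c1) + 1) + c3 * c2)"
  \<comment> \<open>\<open>W * \<delta>\<close> comes from the ball; of the other two factors
    \<open>s\<close>, one counts sides and one bounds the length of a single orbit step.\<close>
  define e where "e = W * \<delta> + 2"
  show ?thesis
  proof (rule exI[of _ c], rule exI[of _ e], intro allI impI)
    fix k n :: nat and gs \<epsilon>
    assume a: "(\<forall>i<k. gs i \<in> carrier G \<and> len (gs i) \<le> n) \<and> len (power_prod gs \<epsilon> 0 k) \<le> n"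
    define A where "A = {\<epsilon>'. power_prod gs \<epsilon>' 0 k = power_prod gs \<epsilon> 0 k}"
    have "A \<noteq> {}"
      by (auto simp: A_def)
    from lex_minimal_exists[OF this, where \<mu> = "\<lambda>\<epsilon> i. nat \<bar>\<epsilon> i\<bar>" and k = k]
    obtain \<eta> where \<eta>: "\<eta> \<in> A" and min: "\<And>\<epsilon>' m. \<epsilon>' \<in> A \<Longrightarrow> m < k \<Longrightarrow>
        \<forall>i<m. nat \<bar>\<epsilon>' i\<bar> = nat \<bar>\<eta> i\<bar> \<Longrightarrow> nat \<bar>\<eta> m\<bar> \<le> nat \<bar>\<epsilon>' m\<bar>"
      by blast
    interpret minimal_power_prod G Y D gs k \<eta>
    proof
      show "gs i \<in> carrier G" if "i < k" for i
        using a that by blast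
      show "\<bar>\<eta> m\<bar> \<le> \<bar>\<epsilon>' m\<bar>"
        if "power_prod gs \<epsilon>' 0 k = power_prod gs \<eta> 0 k" "m < k" "\<forall>i<m. \<bar>\<epsilon>' i\<bar> = \<bar>\<eta> i\<bar>" for \<epsilon>' m
        using min[of \<epsilon>' m] that \<eta> by (simp add: A_def nat_le_eq_zle)
    qed
    obtain N where N: "3 * k \<le> 2 ^ N" "2 ^ N \<le> 2 * (3 * k) + (1 :: nat)"
      using exists_power_of_two by blast
    define s where "s = k + n + 1"
    have s: "1 \<le> s" "3 * k + 1 \<le> 3 * s" "k \<le> s" "n + 1 \<le> s" "2 ^ N \<le> 6 * s"
      using N(2) by (simp_all add: s_def)
    have "N < 2 ^ N"
      by (rule less_exp)
    then have "N + 11 \<le> 17 * s"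
      using s(1,5) by linarith
    moreover have "nat ((int N + 11) * D) = (N + 11) * \<delta>"
      using D_nonneg by (simp add: \<delta>_def nat_mult_distrib nat_add_distrib)
    ultimately have "nat ((int N + 11) * D) \<le> 17 * s * \<delta>"
      by (simp only: mult_le_mono1)
    moreover have "edge_bound n \<le> c1 * s"
      unfolding edge_bound_def c1_def using s(4) by (intro mult_le_mono2)
    ultimately have "2 * (nat ((int N + 11) * D) + edge_bound n) + 1 \<le> 2 * (17 * s * \<delta> + c1 * s) + s"
      using s(1) by (intro add_mono mult_le_mono2)
    also have "\<dots> = (2 * (17 * \<delta> + c1) + 1) * s"
      by (simp add: algebra_simps)
    finally have 1: "(3 * k + 1) * (2 * (nat ((int N + 11) * D) + edge_bound n) + 1) \<le>
        3 * s * ((2 * (17 * \<delta> + c1) + 1) * s)"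
      by (intro mult_le_mono s(2))
    have "(order_bound + 2 * conj_bound) * (n + 1) + 1 \<le> (order_bound + 2 * conj_bound) * s + s"
      using s by (intro add_mono mult_le_mono2)
    also have "\<dots> = c2 * s"
      by (simp add: c2_def algebra_simps)
    finally have "side_bound N n \<le> c3 * s ^ (W * \<delta>) * (c2 * s)"
      using card_ball_polynomial[OF s(5)] unfolding side_bound_def c3_def W_def \<delta>_def
      by (intro mult_le_mono)
    then have 2: "k * side_bound N n \<le> s * (c3 * s ^ (W * \<delta>) * (c2 * s))"
      by (intro mult_le_mono s(3))
    have "1 \<le> s ^ (W * \<delta>)"
      using s(1) by simp
    then have "3 * s * ((2 * (17 * \<delta> + c1) + 1) * s) * 1 \<le> 3 * s * ((2 * (17 * \<delta> + c1) + 1) * s) * s ^ (W * \<delta>)"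
      by (rule mult_le_mono2)
    then have 3: "3 * s * ((2 * (17 * \<delta> + c1) + 1) * s) + s * (c3 * s ^ (W * \<delta>) * (c2 * s)) \<le>
        (3 * (2 * (17 * \<delta> + c1) + 1) + c3 * c2) * s ^ e"
      unfolding e_def power_add power2_eq_square by (simp add: algebra_simps)
    have "nat \<bar>\<eta> i\<bar> \<le> c * s ^ e" if "i < k" for i
    proof -
      have "vertex k = power_prod gs \<epsilon> 0 k"
        using \<eta> by (simp add: vertex_def A_def)
      then have "nat \<bar>\<eta> i\<bar> \<le> order_bound *
          ((3 * k + 1) * (2 * (nat ((int N + 11) * D) + edge_bound n) + 1) + k * side_bound N n)"
        using a by (intro exponent_bound that N(1)) auto
      also have "\<dots> \<le> order_bound * ((3 * (2 * (17 * \<delta> + c1) + 1) + c3 * c2) * s ^ e)"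
        using 1 2 3 by (intro mult_le_mono2) linarith
      finally show ?thesis
        by (simp only: c_def mult.assoc)
    qed
    then show "\<exists>\<epsilon>'. power_prod gs \<epsilon>' 0 k = power_prod gs \<epsilon> 0 k \<and>
        (\<forall>i<k. nat \<bar>\<epsilon>' i\<bar> \<le> c * (k + n + 1) ^ e)"
      using \<eta> by (auto simp: A_def s_def)
  qed
qed

end

text \<open>Each letter of \<open>X\<close> costs at most the total \<open>Y\<close>-length of all
  letters of \<open>X\<close>, a finite sum.\<close>

lemma (in finitely_generated_group) word_length_comparison:
  assumes "finite_generating_set G X"
  shows "\<exists>C. \<forall>h\<in>carrier G. len h \<le> C * word_length G X h"
proof -
  interpret X: finitely_generated_group G X
    using assms by unfold_locales
  let ?C = "\<Sum>x\<in>letters G X. len x"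
  have "len (list_mult G ws) \<le> ?C * length ws" if "set ws \<subseteq> letters G X" for ws
    using that
  proof (induction ws)
    case (Cons x ws)
    have "x \<in> carrier G" "list_mult G ws \<in> carrier G"
      using Cons.prems X.letters_closed X.words_closed by auto
    then have "len (list_mult G (x # ws)) \<le> len x + len (list_mult G ws)"
      by (simp add: len_mult)
    also have "len x \<le> ?C"
      using Cons.prems X.finite_letters by (intro member_le_sum) auto
    finally show ?case
      using Cons by simp
  qed simp
  then show ?thesis
    by (metis X.shortest_word)
qed

text \<open>Used to delete trivial factors. Every remaining one has length at least 1, so their
  number is at most the sum of the lengths.\<close>

lemma (in group) list_mult_filter:
  assumes "\<And>i. i \<in> set xs \<Longrightarrow> f i \<in> carrier G" "\<And>i. i \<in> set xs \<Longrightarrow> \<not> P i \<Longrightarrow> f i = \<one>"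
  shows "list_mult G (map f (filter P xs)) = list_mult G (map f xs)"
  using assms
proof (induction xs)
  case (Cons x xs)
  then have "list_mult G (map f xs) \<in> carrier G"
    by (intro list_mult_closed) auto
  then show ?case
    using Cons by auto
qed simp

lemma (in group) power_prod_nth:
  "power_prod (\<lambda>t. gs (xs ! t)) (\<lambda>t. \<epsilon> (xs ! t)) 0 (length xs) = list_mult G (map (\<lambda>i. gs i [^] \<epsilon> i) xs)"
  unfolding power_prod_def by (intro arg_cong[where f = "list_mult G"] nth_equalityI) auto

theorem theorem6p7:
  fixes G :: "('a, 'b) monoid_scheme" and X :: "'a set"
  assumes "hyperbolic_group G"
    and "finite_generating_set G X"
  shows "\<exists>p :: real poly. \<forall>(k :: nat) (gs :: nat \<Rightarrow> 'a) (g :: 'a).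
    (\<forall>i \<in> {1..k}. gs i \<in> carrier G) \<and> g \<in> carrier G \<longrightarrow>
    (\<exists>\<epsilon> :: nat \<Rightarrow> int.
       g = list_mult G (map (\<lambda>i. gs i [^]\<^bsub>G\<^esub> \<epsilon> i) [1..<Suc k])) \<longrightarrow>
    (\<exists>\<epsilon> :: nat \<Rightarrow> int.
       g = list_mult G (map (\<lambda>i. gs i [^]\<^bsub>G\<^esub> \<epsilon> i) [1..<Suc k]) \<and>
       (\<forall>i \<in> {1..k}. real_of_int \<bar>\<epsilon> i\<bar> \<le>
          poly p (real ((\<Sum>j = 1..k. word_length G X (gs j)) + word_length G X g))))"
proof -
  obtain Y \<delta> where G: "group G" and Y: "finite_generating_set G Y" "slim_triangles G Y \<delta>"
    using assms(1) by (auto simp: hyperbolic_group_def)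
  interpret group G
    by (rule G)
  interpret X: finitely_generated_group G X
    using assms(2) by unfold_locales
  interpret Y: finitely_generated_group G Y
    using Y(1) by unfold_locales
  obtain D where D: "hyperbolic_dist Y.dist D"
    using Y.slim_imp_hyperbolic[OF Y(2)] by blast
  interpret Y: word_hyperbolic_group G Y D
    by (intro word_hyperbolic_group.intro word_hyperbolic_group_axioms.intro D Y.finitely_generated_group_axioms)
  obtain C where C: "\<And>h. h \<in> carrier G \<Longrightarrow> Y.len h \<le> C * X.len h"
    using Y.word_length_comparison[OF assms(2)] by blast
  obtain c e where ce: "\<And>k gs \<epsilon> n. (\<forall>i<k. gs i \<in> carrier G \<and> Y.len (gs i) \<le> n) \<Longrightarrow>
      Y.len (power_prod gs \<epsilon> 0 k) \<le> n \<Longrightarrow>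
      \<exists>\<epsilon>'. power_prod gs \<epsilon>' 0 k = power_prod gs \<epsilon> 0 k \<and> (\<forall>i<k. nat \<bar>\<epsilon>' i\<bar> \<le> c * (k + n + 1) ^ e)"
    using Y.polynomial_exponents by meson
  \<comment> \<open>Both parameters of the bound are controlled by the total length
    \<open>S\<close>: at most \<open>S\<close> factors remain, and all \<open>Y\<close>-lengths are
    at most \<open>C * S\<close>.\<close>
  define p :: "real poly" where "p = smult (real c) ([:1, real (C + 1):] ^ e)"
  have p: "poly p (real S) = real (c * (S + C * S + 1) ^ e)" for S
    by (simp add: p_def algebra_simps)
  show ?thesis
  proof (intro exI[of _ p] allI impI)
    fix k :: nat and gs :: "nat \<Rightarrow> 'a" and g
    assume car: "(\<forall>i\<in>{1..k}. gs i \<in> carrier G) \<and> g \<in> carrier G"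
    assume "\<exists>\<epsilon> :: nat \<Rightarrow> int. g = list_mult G (map (\<lambda>i. gs i [^]\<^bsub>G\<^esub> \<epsilon> i) [1..<Suc k])"
    then obtain \<epsilon> :: "nat \<Rightarrow> int" where \<epsilon>: "g = list_mult G (map (\<lambda>i. gs i [^]\<^bsub>G\<^esub> \<epsilon> i) [1..<Suc k])"
      by blast
    define S where "S = (\<Sum>j = 1..k. X.len (gs j)) + X.len g"
    define xs where "xs = filter (\<lambda>i. gs i \<noteq> \<one>\<^bsub>G\<^esub>) [1..<Suc k]"
    have xs: "distinct xs" "set xs = {i \<in> {1..k}. gs i \<noteq> \<one>\<^bsub>G\<^esub>}"
      by (auto simp: xs_def)
    have prod: "list_mult G (map (\<lambda>i. gs i [^]\<^bsub>G\<^esub> \<eta> i) xs) = list_mult G (map (\<lambda>i. gs i [^]\<^bsub>G\<^esub> \<eta> i) [1..<Suc k])"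
      for \<eta> :: "nat \<Rightarrow> int"
      unfolding xs_def using car by (intro list_mult_filter) auto
    have le: "X.len (gs i) \<le> S" if "i \<in> {1..k}" for i
      unfolding S_def using that by (intro trans_le_add1 member_le_sum) auto
    have "length xs = (\<Sum>i\<in>set xs. 1)"
      using xs(1) by (simp add: distinct_card)
    also have "\<dots> \<le> (\<Sum>i\<in>set xs. X.len (gs i))"
    proof (rule sum_mono)
      fix i assume "i \<in> set xs"
      then show "1 \<le> X.len (gs i)"
        using X.len_eq_0[of "gs i"] car xs(2) by (cases "X.len (gs i)") auto
    qed
    also have "\<dots> \<le> (\<Sum>j = 1..k. X.len (gs j))"
      using xs(2) by (intro sum_mono2) auto
    finally have len_xs: "length xs \<le> S"
      by (simp add: S_def)
    let ?hs = "\<lambda>t. gs (xs ! t)"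
    have nth: "xs ! t \<in> {1..k}" if "t < length xs" for t
      using nth_mem[OF that] xs(2) by auto
    have hs: "\<forall>t<length xs. ?hs t \<in> carrier G \<and> Y.len (?hs t) \<le> C * S"
    proof (intro allI impI conjI)
      fix t assume "t < length xs"
      then have t: "xs ! t \<in> {1..k}"
        by (rule nth)
      then show "?hs t \<in> carrier G"
        using car by blast
      then show "Y.len (?hs t) \<le> C * S"
        using C le[OF t] by (meson le_trans mult_le_mono2)
    qed
    have eq: "power_prod ?hs (\<lambda>t. \<epsilon> (xs ! t)) 0 (length xs) = g"
      unfolding power_prod_nth prod \<epsilon> ..
    have "Y.len g \<le> C * S"
      using C[of g] car by (auto simp: S_def algebra_simps)
    then obtain \<eta> where \<eta>: "power_prod ?hs \<eta> 0 (length xs) = g"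
      "\<forall>t<length xs. nat \<bar>\<eta> t\<bar> \<le> c * (length xs + C * S + 1) ^ e"
      using ce[OF hs, of "\<lambda>t. \<epsilon> (xs ! t)"] unfolding eq by blast
    have inj: "inj_on (\<lambda>t. xs ! t) {..<length xs}"
      using xs(1) by (intro inj_on_nth) auto
    define idx where "idx = inv_into {..<length xs} (\<lambda>t. xs ! t)"
    have idx: "idx (xs ! t) = t" if "t < length xs" for t
      unfolding idx_def by (rule inv_into_f_f[OF inj]) (use that in simp)
    \<comment> \<open>Exponents of deleted trivial factors are arbitrary as far as the product is
      concerned; 0 satisfies the bound.\<close>
    define \<epsilon>' where "\<epsilon>' i = (if i \<in> set xs then \<eta> (idx i) else 0)" for i
    have "power_prod ?hs (\<lambda>t. \<epsilon>' (xs ! t)) 0 (length xs) = power_prod ?hs \<eta> 0 (length xs)"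
      by (rule power_prod_cong) (simp add: \<epsilon>'_def idx)
    then have "g = list_mult G (map (\<lambda>i. gs i [^]\<^bsub>G\<^esub> \<epsilon>' i) [1..<Suc k])"
      unfolding power_prod_nth prod \<eta>(1) by simp
    moreover have "real_of_int \<bar>\<epsilon>' i\<bar> \<le> poly p (real S)" for i
    proof (cases "i \<in> set xs")
      case True
      then obtain t where t: "t < length xs" "i = xs ! t"
        by (metis in_set_conv_nth)
      then have "nat \<bar>\<epsilon>' i\<bar> \<le> c * (length xs + C * S + 1) ^ e"
        using True \<eta>(2) idx by (simp add: \<epsilon>'_def)
      also have "\<dots> \<le> c * (S + C * S + 1) ^ e"
        using len_xs by (intro mult_le_mono2 power_mono) auto
      finally show ?thesis
        unfolding p by linarith
    next
      case False
      then show ?thesis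
        unfolding p by (simp add: \<epsilon>'_def)
    qed
    ultimately show "\<exists>\<epsilon> :: nat \<Rightarrow> int. g = list_mult G (map (\<lambda>i. gs i [^]\<^bsub>G\<^esub> \<epsilon> i) [1..<Suc k]) \<and>
       (\<forall>i \<in> {1..k}. real_of_int \<bar>\<epsilon> i\<bar> \<le>
          poly p (real ((\<Sum>j = 1..k. word_length G X (gs j)) + word_length G X g)))"
      unfolding S_def by blast
  qed
qed

end
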